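(* Suppose $\Gamma$ is a non-complete graph on $n$ vertices that is either $2$-regular or $(n-3)$-regular. Then $A_{\Gamma}$ has the $R_\infty$-property.
   Context: A graph is a finite simple non-empty graph $\Gamma(V,E)$; it is complete if every two distinct vertices are joined by an edge, and $k$-regular if every vertex has degree $k$. The right-angled Artin group associated to $\Gamma$ is $A_\Gamma=\langle V \mid [v,w],\ vw\in E\rangle$. For a group $G$ and $\varphi\in\operatorname{Aut}(G)$, elements $x,y\in G$ are $\varphi$-conjugate if $x=gy\varphi(g)^{-1}$ for some $g\in G$; the Reidemeister number $R(\varphi)$ is the number of $\varphi$-conjugacy classes ($\infty$ if there are infinitely many). $G$ has the $R_\infty$-property if $R(\varphi)=\infty$ for all $\varphi\in\operatorname{Aut}(G)$. *)

theory Defs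
  imports
    "HOL-Library.Extended_Nat"
    "Graph_Theory.Graph_Theory"
    "HOL-Algebra.Bij"
begin

section \<open>Group presentations\<close>

text \<open>
  A letter \<open>(s, True)\<close> stands for the generator \<open>s\<close>, and \<open>(s, False)\<close> for its formal inverse.
\<close>

type_synonym 'a word = "('a \<times> bool) list"

abbreviation words :: "'a set \<Rightarrow> 'a word set" where
  "words S \<equiv> lists (S \<times> UNIV)"

text \<open>
  The congruence on words over \<open>S\<close> generated by free cancellation and by the relators in \<open>R\<close>.
\<close>

inductive_set presentation_rel :: "'a set \<Rightarrow> 'a word set \<Rightarrow> 'a word rel"
  for S :: "'a set" and R :: "'a word set" where
  refl: "w \<in> words S \<Longrightarrow> (w, w) \<in> presentation_rel S R"
| sym: "(u, v) \<in> presentation_rel S R \<Longrightarrow> (v, u) \<in> presentation_rel S R"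
| trans: "\<lbrakk>(u, v) \<in> presentation_rel S R; (v, w) \<in> presentation_rel S R\<rbrakk>
    \<Longrightarrow> (u, w) \<in> presentation_rel S R"
| cancel: "\<lbrakk>u \<in> words S; v \<in> words S; s \<in> S\<rbrakk>
    \<Longrightarrow> (u @ [(s, b), (s, \<not> b)] @ v, u @ v) \<in> presentation_rel S R"
| relator: "\<lbrakk>u \<in> words S; v \<in> words S; r \<in> R\<rbrakk>
    \<Longrightarrow> (u @ r @ v, u @ v) \<in> presentation_rel S R"

text \<open>The group \<open>\<langle>S | R\<rangle>\<close>, for \<open>R \<subseteq> words S\<close>.\<close>

definition presented_group :: "'a set \<Rightarrow> 'a word set \<Rightarrow> 'a word set monoid" where
  "presented_group S R =
    \<lparr>carrier = words S // presentation_rel S R,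
     mult = (\<lambda>A B. \<Union>a\<in>A. \<Union>b\<in>B. presentation_rel S R `` {a @ b}),
     one = presentation_rel S R `` {[]}\<rparr>"

definition inverse_word :: "'a word \<Rightarrow> 'a word" where
  "inverse_word w = rev (map (\<lambda>(s, b). (s, \<not> b)) w)"

lemma presentation_rel_words:
  assumes "R \<subseteq> words S" "(u, v) \<in> presentation_rel S R"
  shows "u \<in> words S \<and> v \<in> words S"
  using assms(2)
proof (induction rule: presentation_rel.induct)
  case (relator u v r)
  then show ?case using assms(1) by auto
qed auto

lemma equiv_presentation_rel:
  assumes "R \<subseteq> words S"
  shows "equiv (words S) (presentation_rel S R)"
proof (rule equivI)
  show "presentation_rel S R \<subseteq> words S \<times> words S"
    using presentation_rel_words[OF assms] by (simp add: subset_iff)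
  show "refl_on (words S) (presentation_rel S R)"
    by (auto intro!: refl_onI presentation_rel.refl)
  show "sym (presentation_rel S R)"
    by (auto intro!: symI intro: presentation_rel.sym)
  show "trans (presentation_rel S R)"
    by (auto intro!: transI intro: presentation_rel.trans)
qed

lemma presentation_rel_context:
  assumes "(u, v) \<in> presentation_rel S R" "a \<in> words S" "b \<in> words S"
  shows "(a @ u @ b, a @ v @ b) \<in> presentation_rel S R"
  using assms(1)
proof (induction rule: presentation_rel.induct)
  case (refl w)
  then show ?case
    using presentation_rel.refl[of "a @ w @ b" S R] assms(2,3) by auto
next
  case (sym u v)
  then show ?case by (auto intro: presentation_rel.sym)
next
  case (trans u v w)
  then show ?case by (blast intro: presentation_rel.trans)
next
  case (cancel u v s c)
  then show ?case
    using presentation_rel.cancel[of "a @ u" S "v @ b" s c R] assms(2,3) by auto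
next
  case (relator u v r)
  then show ?case
    using presentation_rel.relator[of "a @ u" S "v @ b" r R] assms(2,3) by auto
qed

lemma presentation_rel_append:
  assumes "R \<subseteq> words S" "(u, u') \<in> presentation_rel S R" "(v, v') \<in> presentation_rel S R"
  shows "(u @ v, u' @ v') \<in> presentation_rel S R"
proof -
  have w: "u \<in> words S" "u' \<in> words S" "v \<in> words S" "v' \<in> words S"
    using presentation_rel_words[OF assms(1)] assms(2,3) by auto
  have "(u @ v, u' @ v) \<in> presentation_rel S R"
    using presentation_rel_context[OF assms(2), of "[]" v] w by simp
  moreover have "(u' @ v, u' @ v') \<in> presentation_rel S R"
    using presentation_rel_context[OF assms(3), of u' "[]"] w by simp
  ultimately show ?thesis by (rule presentation_rel.trans)
qed

lemma presented_group_mult: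
  assumes "R \<subseteq> words S" "u \<in> words S" "v \<in> words S"
  shows "presentation_rel S R `` {u} \<otimes>\<^bsub>presented_group S R\<^esub> presentation_rel S R `` {v}
    = presentation_rel S R `` {u @ v}"
proof -
  note eq = equiv_presentation_rel[OF assms(1)]
  have "congruent2 (presentation_rel S R) (presentation_rel S R)
      (\<lambda>a b. presentation_rel S R `` {a @ b})"
    by (rule congruent2I', rule equiv_class_eq[OF eq])
      (rule presentation_rel_append[OF assms(1)])
  from UN_equiv_class2[OF eq eq this assms(2,3)] show ?thesis
    by (simp add: presented_group_def)
qed

lemma inverse_word_in_words: "w \<in> words S \<Longrightarrow> inverse_word w \<in> words S"
  by (auto simp: inverse_word_def)

lemma inverse_word_left:
  assumes "w \<in> words S"
  shows "(inverse_word w @ w, []) \<in> presentation_rel S R"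
  using assms
proof (induction w)
  case Nil
  then show ?case by (simp add: inverse_word_def presentation_rel.refl)
next
  case (Cons x w)
  obtain s b where x: "x = (s, b)" by (cases x)
  have w: "w \<in> words S" "inverse_word w \<in> words S" "s \<in> S"
    using Cons.hyps Cons.prems inverse_word_in_words x by auto
  have "(inverse_word w @ [(s, \<not> b), (s, \<not> \<not> b)] @ w, inverse_word w @ w) \<in> presentation_rel S R"
    using w by (intro presentation_rel.cancel)
  moreover have "inverse_word (x # w) @ x # w
      = inverse_word w @ [(s, \<not> b), (s, \<not> \<not> b)] @ w"
    by (simp add: inverse_word_def x)
  ultimately show ?case
    using Cons.IH w(1) by (metis presentation_rel.trans)
qed

lemma group_presented_group:
  assumes "R \<subseteq> words S"
  shows "group (presented_group S R)"
proof -
  let ?G = "presented_group S R" and ?c = "\<lambda>w. presentation_rel S R `` {w}"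
  note eq = equiv_presentation_rel[OF assms] and mult = presented_group_mult[OF assms]
  have car: "carrier ?G = ?c ` words S" and one: "\<one>\<^bsub>?G\<^esub> = ?c []"
    by (auto simp: presented_group_def quotient_def)
  show ?thesis
  proof (rule groupI)
    fix x y assume "x \<in> carrier ?G" "y \<in> carrier ?G"
    then obtain u v where "u \<in> words S" "v \<in> words S" "x = ?c u" "y = ?c v"
      by (auto simp: car)
    then show "x \<otimes>\<^bsub>?G\<^esub> y \<in> carrier ?G" by (auto simp: car mult)
  next
    show "\<one>\<^bsub>?G\<^esub> \<in> carrier ?G" by (auto simp: car one)
  next
    fix x y z assume "x \<in> carrier ?G" "y \<in> carrier ?G" "z \<in> carrier ?G"
    then obtain u v w where "u \<in> words S" "v \<in> words S" "w \<in> words S"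
      "x = ?c u" "y = ?c v" "z = ?c w"
      unfolding car by blast
    then show "x \<otimes>\<^bsub>?G\<^esub> y \<otimes>\<^bsub>?G\<^esub> z = x \<otimes>\<^bsub>?G\<^esub> (y \<otimes>\<^bsub>?G\<^esub> z)"
      by (simp add: mult)
  next
    fix x assume "x \<in> carrier ?G"
    then obtain u where u: "u \<in> words S" "x = ?c u" unfolding car by blast
    then show "\<one>\<^bsub>?G\<^esub> \<otimes>\<^bsub>?G\<^esub> x = x" by (simp add: one mult)
    have "?c (inverse_word u) \<otimes>\<^bsub>?G\<^esub> x = \<one>\<^bsub>?G\<^esub>"
      using u equiv_class_eq[OF eq inverse_word_left[OF u(1)]]
      by (simp add: one mult inverse_word_in_words)
    then show "\<exists>y\<in>carrier ?G. y \<otimes>\<^bsub>?G\<^esub> x = \<one>\<^bsub>?G\<^esub>"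
      using u(1) inverse_word_in_words unfolding car by blast
  qed
qed


section \<open>Right-angled Artin groups\<close>

definition commutator_word :: "'a \<Rightarrow> 'a \<Rightarrow> 'a word" where
  "commutator_word v w = [(v, True), (w, True), (v, False), (w, False)]"

definition RAAG :: "('a, 'b) pre_digraph \<Rightarrow> 'a word set monoid" where
  "RAAG \<Gamma> = presented_group (verts \<Gamma>) {commutator_word v w | v w. (v, w) \<in> arcs_ends \<Gamma>}"

lemma group_RAAG:
  assumes "wf_digraph \<Gamma>"
  shows "group (RAAG \<Gamma>)"
  unfolding RAAG_def
proof (rule group_presented_group)
  show "{commutator_word v w | v w. (v, w) \<in> arcs_ends \<Gamma>} \<subseteq> words (verts \<Gamma>)"
    using assms
    by (auto simp: commutator_word_def arcs_ends_conv wf_digraph_def)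
qed


section \<open>Regular graphs\<close>

text \<open>
  In the symmetric, loop-free digraphs without parallel arcs that make up the locale
  \<^locale>\<open>graph\<close>, each undirected edge is a pair of opposite arcs, so the degree of a vertex
  is its out-degree.
\<close>

definition regular_graph :: "nat \<Rightarrow> ('a, 'b) pre_digraph \<Rightarrow> bool" where
  "regular_graph k \<Gamma> \<longleftrightarrow> (\<forall>v \<in> verts \<Gamma>. out_degree \<Gamma> v = k)"


section \<open>Twisted conjugacy\<close>

definition twisted_conj_rel :: "('g, 'm) monoid_scheme \<Rightarrow> ('g \<Rightarrow> 'g) \<Rightarrow> 'g rel" where
  "twisted_conj_rel G \<phi> = {(x, y) \<in> carrier G \<times> carrier G.
     \<exists>g \<in> carrier G. x = g \<otimes>\<^bsub>G\<^esub> y \<otimes>\<^bsub>G\<^esub> inv\<^bsub>G\<^esub> (\<phi> g)}"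

definition reidemeister_number :: "('g, 'm) monoid_scheme \<Rightarrow> ('g \<Rightarrow> 'g) \<Rightarrow> enat" where
  "reidemeister_number G \<phi> =
    (let C = carrier G // twisted_conj_rel G \<phi> in if finite C then enat (card C) else \<infinity>)"

text \<open>\<^term>\<open>auto G\<close> is the set of automorphisms of \<open>G\<close>, extended by \<^const>\<open>undefined\<close>
  outside the carrier.\<close>

definition R_infinity_property :: "('g, 'm) monoid_scheme \<Rightarrow> bool" where
  "R_infinity_property G \<longleftrightarrow> (\<forall>\<phi> \<in> auto G. reidemeister_number G \<phi> = \<infinity>)"

end

theory Submission
  imports Defs "HOL-Algebra.Generated_Groups" "HOL-Computational_Algebra.Formal_Power_Series"
    "Jordan_Normal_Form.Schur_Decomposition"
begin

text \<open>
  Write \<open>G\<close> for the Artin group,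
  \<open>N\<close> for the kernel of \<open>G \<rightarrow> \<int>\<^sup>V\<close>, and let \<open>\<phi>\<close> be an automorphism of \<open>G\<close>.
  If \<open>\<phi>\<close> fixes no nonzero element of \<open>\<int>\<^sup>V\<close>, then elements of \<open>N\<close> that are
  \<open>\<phi>\<close>-conjugate in \<open>G\<close> are so in \<open>N\<close>; hence it suffices to find a nonzero homomorphism
  \<open>F : N \<rightarrow> \<complex>\<close> with \<open>F \<circ> \<phi> = F\<close>.

  Two homomorphisms \<open>\<alpha>, \<beta> : G \<rightarrow> \<complex>\<close> have zero cup product iff
  \<open>\<alpha>(v) \<beta>(w) = \<alpha>(w) \<beta>(v)\<close> for all edges \<open>vw\<close>. Since \<open>\<phi>\<close> preserves this relation, for a
  regular graph its action on \<open>Hom(G, \<complex>) = \<complex>\<^sup>V\<close> permutes the coordinate subspaces belonging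
  to the classes of twin vertices (\<open>v\<close> and \<open>w\<close> are twins if they have the same neighbours apart
  from each other).

  If the cup product of \<open>\<alpha>\<close> and \<open>\<beta>\<close> vanishes, there is a power series valued cocycle
  \<open>c(gh) = c(g) + exp(t \<alpha>(g)) c(h)\<close> with constant term \<open>\<beta>\<close>. Its coefficients are polynomial
  functions on \<open>G\<close>, so the coefficient functions composed with the powers of \<open>\<phi>\<close> span a
  finite-dimensional space, and on \<open>N\<close> they are homomorphisms. On an iterated commutator
  \<open>[x\<^sub>1, [\<dots>, [x\<^sub>r, [x, y]]]]\<close> the leading coefficient is
  \<open>\<alpha>(x\<^sub>1) \<cdots> \<alpha>(x\<^sub>r) (\<alpha>(x) \<beta>(y) - \<alpha>(y) \<beta>(x))\<close>. Taking for the entries eigenvectors of a power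
  of \<open>\<phi>\<close> on the twin classes \<open>A, B\<close> of two non-adjacent vertices, with multiplicities such that
  the product of the eigenvalues is a product of squared determinants of integer matrices,
  that is 1, and summing over the \<open>\<phi>\<close>-orbit, gives a \<open>\<phi>\<close>-invariant functional that does not vanish
  on the finite-dimensional space. Hence 1 is an eigenvalue of \<open>\<phi>\<close> there, which yields \<open>F\<close>.
\<close>

section \<open>Linear algebra\<close>

text \<open>Gaussian elimination, by induction on the equations. A pivot \<open>z\<close> with
  \<open>f z y \<noteq> 0\<close> solves equation \<open>y\<close> for the unknown
  \<open>c z\<close>, and substitution leaves the system \<open>g\<close> in the unknowns
  \<open>X - {z}\<close>. If no coefficient of equation \<open>y\<close> is nonzero, the equation is
  dropped.\<close>

lemma underdetermined_system:
  fixes f :: "'x \<Rightarrow> 'y \<Rightarrow> 'k::field"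
  assumes "finite Y" "finite X" "card Y < card X"
  shows "\<exists>c. (\<exists>x\<in>X. c x \<noteq> 0) \<and> (\<forall>y\<in>Y. (\<Sum>x\<in>X. c x * f x y) = 0)"
  using assms
proof (induction Y arbitrary: X f rule: finite_induct)
  case empty
  then have "X \<noteq> {}" by auto
  then show ?case by (intro exI[of _ "\<lambda>_. 1"]) auto
next
  case (insert y Y)
  show ?case
  proof (cases "\<exists>z\<in>X. f z y \<noteq> 0")
    case False
    have "card Y < card X" using insert by simp
    from insert.IH[OF insert.prems(1) this, of f] False show ?thesis
      by auto
  next
    case True
    then obtain z where z: "z \<in> X" "f z y \<noteq> 0" by blast
    define g where "g x t = f x t - f x y / f z y * f z t" for x t
    have "card Y < card (X - {z})" using insert z by simp
    from insert.IH[OF _ this, of g] insert.prems(1) obtain c where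
      c: "\<exists>x\<in>X - {z}. c x \<noteq> 0" "\<forall>t\<in>Y. (\<Sum>x\<in>X - {z}. c x * g x t) = 0" by auto
    define s where "s = (\<Sum>x\<in>X - {z}. c x * f x y) / f z y"
    define d where "d = c(z := - s)"
    have expand: "(\<Sum>x\<in>X. d x * f x t) = - s * f z t + (\<Sum>x\<in>X - {z}. c x * f x t)" for t
      using sum.remove[OF insert.prems(1) z(1), of "\<lambda>x. d x * f x t"]
      by (simp add: d_def)
    have "(\<Sum>x\<in>X. d x * f x t) = (\<Sum>x\<in>X - {z}. c x * g x t)" for t
      unfolding expand s_def g_def
      by (simp add: algebra_simps sum_subtractf sum_distrib_left sum_divide_distrib)
    then have "\<forall>t\<in>Y. (\<Sum>x\<in>X. d x * f x t) = 0" using c by simp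
    moreover have "(\<Sum>x\<in>X. d x * f x y) = 0" using z unfolding expand s_def by simp
    moreover have "\<exists>x\<in>X. d x \<noteq> 0" using c(1) by (auto simp: d_def)
    ultimately show ?thesis by (intro exI[of _ d]) simp
  qed
qed

text \<open>This is \<open>p(T) f\<close> for the operator \<open>T\<close> that sends
  \<open>f\<close> to \<open>f \<circ> \<phi>\<close>, so that the eigenvalue 1 of \<open>T\<close>
  on the span of the iterates can be read off from annihilating polynomials.\<close>

definition iterate_comb :: "('g \<Rightarrow> 'g) \<Rightarrow> ('g \<Rightarrow> complex) \<Rightarrow> complex poly \<Rightarrow> 'g \<Rightarrow> complex" where
  "iterate_comb \<phi> f p x = (\<Sum>i\<le>degree p. coeff p i * f ((\<phi> ^^ i) x))"

lemma iterate_comb_eq: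
  assumes "degree p \<le> n"
  shows "iterate_comb \<phi> f p x = (\<Sum>i\<le>n. coeff p i * f ((\<phi> ^^ i) x))"
  unfolding iterate_comb_def using assms
  by (intro sum.mono_neutral_left) (auto simp: coeff_eq_0)

lemma iterate_comb_diff: "iterate_comb \<phi> f (p - q) x = iterate_comb \<phi> f p x - iterate_comb \<phi> f q x"
proof -
  let ?n = "max (degree p) (degree q)"
  show ?thesis
    by (subst (1 2 3) iterate_comb_eq[where n = ?n])
      (auto simp: degree_diff_le sum_subtractf algebra_simps)
qed

lemma iterate_comb_pCons_0: "iterate_comb \<phi> f (pCons 0 q) x = iterate_comb \<phi> f q (\<phi> x)"
proof -
  have "iterate_comb \<phi> f (pCons 0 q) x = (\<Sum>i\<le>Suc (degree q). coeff (pCons 0 q) i * f ((\<phi> ^^ i) x))"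
    by (rule iterate_comb_eq) (simp add: degree_pCons_le)
  also have "\<dots> = (\<Sum>i\<le>degree q. coeff q i * f ((\<phi> ^^ Suc i) x))"
    unfolding sum.atMost_Suc_shift by simp
  finally show ?thesis by (simp add: iterate_comb_def funpow_swap1)
qed

text \<open>A nonzero annihilator \<open>p\<close> of least degree has the root 1, so
  \<open>p = (X - 1) q\<close>. By minimality \<open>q(T) f\<close> does not vanish on
  \<open>N\<close>, and \<open>(T - 1) q(T) f = 0\<close> says that it is fixed.\<close>

lemma fixed_combination:
  assumes nz: "p\<^sub>0 \<noteq> 0" "\<And>x. x \<in> N \<Longrightarrow> iterate_comb \<phi> f p\<^sub>0 x = 0"
    and one: "\<And>p. (\<And>x. x \<in> N \<Longrightarrow> iterate_comb \<phi> f p x = 0) \<Longrightarrow> poly p 1 = 0"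
  shows "\<exists>q. (\<exists>x\<in>N. iterate_comb \<phi> f q x \<noteq> 0) \<and> (\<forall>x\<in>N. iterate_comb \<phi> f q (\<phi> x) = iterate_comb \<phi> f q x)"
proof -
  define I where "I = {p. p \<noteq> 0 \<and> (\<forall>x\<in>N. iterate_comb \<phi> f p x = 0)}"
  have "p\<^sub>0 \<in> I" using nz by (simp add: I_def)
  then obtain p where p: "p \<in> I" "\<And>q. q \<in> I \<Longrightarrow> degree p \<le> degree q"
    using arg_min_natI[of "\<lambda>p. p \<in> I" p\<^sub>0 degree] arg_min_nat_le[of "\<lambda>p. p \<in> I" _ degree]
    by metis
  from p(1) one[of p] have "poly p 1 = 0" by (auto simp: I_def)
  then obtain q where q: "p = [:-1, 1:] * q" by (metis poly_eq_0_iff_dvd dvdE)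
  have "q \<noteq> 0" using p(1) q by (auto simp: I_def)
  then have "degree p = Suc (degree q)" unfolding q by (subst degree_mult_eq) auto
  with p(2)[of q] \<open>q \<noteq> 0\<close> have nz': "\<exists>x\<in>N. iterate_comb \<phi> f q x \<noteq> 0" by (force simp: I_def)
  have "p = pCons 0 q - q" unfolding q by simp
  then have "iterate_comb \<phi> f p x = iterate_comb \<phi> f q (\<phi> x) - iterate_comb \<phi> f q x" for x
    by (simp add: iterate_comb_diff iterate_comb_pCons_0)
  with p(1) nz' show ?thesis by (intro exI[of _ q]) (auto simp: I_def)
qed

text \<open>\<open>\<alpha>\<close> is a functional, stored by its values on the basis, and
  \<open>x\<close> is a vector. The set is a parameter because the same sum is also taken over a
  single block of vertices.\<close>

definition pairing :: "'a set \<Rightarrow> ('a \<Rightarrow> complex) \<Rightarrow> ('a \<Rightarrow> complex) \<Rightarrow> complex" where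
  "pairing V \<alpha> x = (\<Sum>v\<in>V. \<alpha> v * x v)"

text \<open>Finitely many proper hyperplanes do not cover the space of functionals. A multiple
  \<open>s\<close> of the coordinate functional at \<open>v\<close>, where
  \<open>z v \<noteq> 0\<close>, is added to a functional that is good for \<open>xs\<close>; each
  vector that is nonzero at \<open>v\<close> excludes one value of \<open>s\<close>.\<close>

lemma generic_functional:
  assumes "finite A" "\<And>x. x \<in> set xs \<Longrightarrow> \<exists>v\<in>A. x v \<noteq> 0"
  shows "\<exists>\<alpha>. \<forall>x\<in>set xs. pairing A \<alpha> x \<noteq> 0"
  using assms(2)
proof (induction xs)
  case (Cons z xs)
  then obtain \<alpha> where \<alpha>: "\<forall>x\<in>set xs. pairing A \<alpha> x \<noteq> 0" by auto
  obtain v where v: "v \<in> A" "z v \<noteq> 0" using Cons.prems[of z] by auto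
  have sum: "pairing A (\<lambda>u. \<alpha> u + (if u = v then s else 0)) x = pairing A \<alpha> x + s * x v" for s x
    using assms(1) v(1)
    by (simp add: pairing_def distrib_right sum.distrib if_distrib[of "\<lambda>t. t * _"] cong: if_cong)
  define bad where "bad = (\<lambda>x. - pairing A \<alpha> x / x v) ` set (z # xs) "
  have "finite bad" by (simp add: bad_def)
  then obtain s where s: "s \<notin> insert 0 bad"
    using ex_new_if_finite[OF infinite_UNIV_char_0, of "insert 0 bad"] by auto
  have "pairing A \<alpha> x + s * x v \<noteq> 0" if "x \<in> set (z # xs)" for x
  proof (cases "x v = 0")
    case True
    then show ?thesis using that \<alpha> v by auto
  next
    case False
    have "s \<noteq> - pairing A \<alpha> x / x v" using s that by (auto simp: bad_def)
    with False show ?thesis by (auto simp: field_simps add_eq_0_iff)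
  qed
  then show ?case by (intro exI[of _ "\<lambda>u. \<alpha> u + (if u = v then s else 0)"]) (auto simp: sum)
qed auto

section \<open>Eigenvalues and eigenvectors of invertible integer matrices\<close>

definition indep2 :: "'a set \<Rightarrow> ('a \<Rightarrow> complex) \<Rightarrow> ('a \<Rightarrow> complex) \<Rightarrow> bool" where
  "indep2 A x y \<longleftrightarrow> (\<forall>a b. (\<forall>v\<in>A. a * x v + b * y v = 0) \<longrightarrow> a = 0 \<and> b = 0)"

definition eigenpair :: "'a set \<Rightarrow> ('a \<Rightarrow> 'a \<Rightarrow> int) \<Rightarrow> complex \<times> ('a \<Rightarrow> complex) \<Rightarrow> bool" where
  "eigenpair A K = (\<lambda>(l, x). (\<exists>v\<in>A. x v \<noteq> 0) \<and> (\<forall>w\<in>A. (\<Sum>v\<in>A. of_int (K w v) * x v) = l * x w))"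

text \<open>An integer matrix with an integer inverse has determinant 1 or -1, so the product of its
  complex eigenvalues squares to 1. Two independent eigenvectors need not exist; the first two
  columns of the base change in a Schur decomposition take their place.\<close>

lemma integer_eigenpairs:
  fixes K K' :: "'a \<Rightarrow> 'a \<Rightarrow> int"
  assumes "finite A"
    and inv: "\<And>w w'. w \<in> A \<Longrightarrow> w' \<in> A \<Longrightarrow> (\<Sum>v\<in>A. K w v * K' v w') = (if w = w' then 1 else 0)"
  shows "\<exists>evs. length evs = card A \<and> (prod_list (map fst evs))\<^sup>2 = 1 \<and> list_all (eigenpair A K) evs
     \<and> (2 \<le> card A \<longrightarrow> (\<exists>x y c. indep2 A x y \<and> eigenpair A K (fst (evs ! 0), x) \<and>
          (\<forall>w\<in>A. (\<Sum>v\<in>A. of_int (K w v) * y v) = fst (evs ! 1) * y w + c * x w)))"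
proof -
  define n where "n = card A"
  obtain e where e: "bij_betw e {0..<n} A"
    using ex_bij_betw_nat_finite[OF assms(1)] n_def by auto
  define d where "d = the_inv_into {0..<n} e"
  have d: "bij_betw d A {0..<n}" unfolding d_def by (rule bij_betw_the_inv_into[OF e])
  have de: "d (e i) = i" if "i < n" for i
    using that e unfolding d_def by (simp add: bij_betw_def the_inv_into_f_f)
  have ed: "e (d v) = v" if "v \<in> A" for v
    using that e unfolding d_def by (simp add: bij_betw_def f_the_inv_into_f)
  have dn: "d v < n" if "v \<in> A" for v using that d by (auto simp: bij_betw_def)
  have eA: "e i \<in> A" if "i < n" for i using that e by (auto simp: bij_betw_def)
  have reindex: "(\<Sum>v\<in>A. g v) = (\<Sum>i\<in>{0..<n}. g (e i))" for g :: "'a \<Rightarrow> 'c::comm_monoid_add"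
    using sum.reindex_bij_betw[OF e, of g] by simp
  define B where "B = mat n n (\<lambda>(i, j). K (e i) (e j))"
  define B' where "B' = mat n n (\<lambda>(i, j). K' (e i) (e j))"
  have car: "B \<in> carrier_mat n n" "B' \<in> carrier_mat n n" by (auto simp: B_def B'_def)
  have "B * B' = 1\<^sub>m n"
  proof (rule eq_matI)
    fix i j assume "i < dim_row (1\<^sub>m n)" "j < dim_col (1\<^sub>m n)"
    then have ij: "i < n" "j < n" by auto
    have "(B * B') $$ (i, j) = (\<Sum>k\<in>{0..<n}. K (e i) (e k) * K' (e k) (e j))"
      using ij by (simp add: B_def B'_def scalar_prod_def)
    also have "\<dots> = (if e i = e j then 1 else 0)"
      using inv[OF eA[OF ij(1)] eA[OF ij(2)]] unfolding reindex .
    also have "\<dots> = 1\<^sub>m n $$ (i, j)" using ij de by (metis index_one_mat(1))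
    finally show "(B * B') $$ (i, j) = 1\<^sub>m n $$ (i, j)" .
  qed (use car in auto)
  then have "det B * det B' = 1" using det_mult[OF car] by simp
  then have "det B = 1 \<or> det B = -1" by (simp add: zmult_eq_1_iff) blast
  then have detB: "(det B)\<^sup>2 = 1" by auto
  define C :: "complex mat" where "C = map_mat of_int B"
  have C: "C \<in> carrier_mat n n" using car by (simp add: C_def)
  have detC: "(det C)\<^sup>2 = 1"
    using detB unfolding C_def of_int_hom.hom_det by (metis of_int_1 of_int_power)
  \<comment> \<open>\<open>es\<close> lists the eigenvalues with algebraic multiplicity, so that its
    product is the determinant. Equal entries later share one eigenvector.\<close>
  obtain es where es: "char_poly C = (\<Prod>a\<leftarrow>es. [:- a, 1:])" "length es = n"
    using char_poly_factorized[OF C] by auto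
  obtain D P Q where "schur_decomposition C es = (D, P, Q)"
    using prod_cases3 by blast
  from schur_decomposition[OF C es(1) this]
  have wit: "similar_mat_wit C D P Q" and ut: "upper_triangular D" and dg: "diag_mat D = es"
    by auto
  from similar_mat_witD2[OF C wit]
  have PQ: "P * Q = 1\<^sub>m n" "Q * P = 1\<^sub>m n" "C = P * D * Q" "D \<in> carrier_mat n n"
    "P \<in> carrier_mat n n" "Q \<in> carrier_mat n n" by auto
  have "det C = det D" using wit by (intro det_similar) (auto simp: similar_mat_def)
  also have "\<dots> = prod_list es" using det_upper_triangular[OF ut PQ(4)] dg by simp
  finally have prod: "(prod_list es)\<^sup>2 = 1" using detC by simp
  define fn where "fn u v = u $ d v" for u :: "complex vec" and v
  have mulC: "(\<Sum>v\<in>A. of_int (K w v) * fn u v) = fn (C *\<^sub>v u) w"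
    if "u \<in> carrier_vec n" "w \<in> A" for u w
    using that dn[OF that(2)] unfolding reindex fn_def
    by (simp add: C_def B_def scalar_prod_def ed de)
  have fnz: "\<exists>v\<in>A. fn u v \<noteq> 0" if u: "u \<in> carrier_vec n" "u \<noteq> 0\<^sub>v n" for u
  proof -
    obtain i where "i < n" "u $ i \<noteq> 0" using u by (metis carrier_vecD eq_vecI index_zero_vec)
    then show ?thesis using eA de by (auto simp: fn_def intro!: bexI[of _ "e i"])
  qed
  have "\<exists>x. eigenpair A K (l, x)" if "l \<in> set es" for l
  proof -
    have "poly (char_poly C) l = 0" using that unfolding es(1) by (simp add: poly_prod_list prod_list_zero_iff)
    then have "eigenvalue C l" using eigenvalue_root_char_poly[OF C] by simp
    then obtain u where u: "u \<in> carrier_vec n" "u \<noteq> 0\<^sub>v n" "C *\<^sub>v u = l \<cdot>\<^sub>v u"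
      using C by (auto simp: eigenvalue_def eigenvector_def)
    have "eigenpair A K (l, fn u)"
      using mulC[OF u(1)] fnz[OF u(1,2)] u dn by (auto simp: eigenpair_def fn_def)
    then show ?thesis by blast
  qed
  then obtain ev where ev: "\<And>l. l \<in> set es \<Longrightarrow> eigenpair A K (l, ev l)" by metis
  define evs where "evs = map (\<lambda>l. (l, ev l)) es"
  have 1: "length evs = card A" "map fst evs = es" "list_all (eigenpair A K) evs"
    using es(2) ev by (auto simp: evs_def n_def comp_def list_all_iff)
  moreover have "\<exists>x y c. indep2 A x y \<and> eigenpair A K (es ! 0, x) \<and>
          (\<forall>w\<in>A. (\<Sum>v\<in>A. of_int (K w v) * y v) = es ! 1 * y w + c * x w)" if "2 \<le> n"
  proof -
    have CP: "C * P = P * D"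
    proof -
      have "C * P = P * D * (Q * P)" using PQ by (simp add: assoc_mult_mat[of _ n n _ n _ n])
      then show ?thesis using PQ by simp
    qed
    \<comment> \<open>As \<open>D\<close> is upper triangular with diagonal \<open>es\<close>, the
      first two columns of \<open>C * P = P * D\<close> express \<open>C x\<close> as a multiple of
      \<open>x\<close>, and \<open>C y\<close> as a multiple of \<open>y\<close> plus a multiple of
      \<open>x\<close>.\<close>
    define x y where "x = col P 0" and "y = col P 1"
    have xy: "x \<in> carrier_vec n" "y \<in> carrier_vec n" using PQ(5) that by (auto simp: x_def y_def)
    have D: "D $$ (0, 0) = es ! 0" "D $$ (1, 1) = es ! 1"
      using dg PQ(4) that by (auto simp: diag_mat_def)
    have D0: "D $$ (i, j) = 0" if "j < i" "i < n" for i j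
      using ut that PQ(4) by (auto simp: upper_triangular_def)
    have colmul: "(C *\<^sub>v col P j) $ i = (\<Sum>k\<in>{0..<n}. P $$ (i, k) * D $$ (k, j))"
      if "i < n" "j < n" for i j
    proof -
      have "(C *\<^sub>v col P j) $ i = (C * P) $$ (i, j)" using that C PQ(5) by simp
      then show ?thesis using that PQ(4,5) unfolding CP by (simp add: scalar_prod_def)
    qed
    have Cx: "C *\<^sub>v x = es ! 0 \<cdot>\<^sub>v x"
    proof (rule eq_vecI)
      fix i assume "i < dim_vec (es ! 0 \<cdot>\<^sub>v x)"
      then have i: "i < n" using xy by auto
      have "(\<Sum>k\<in>{0..<n}. P $$ (i, k) * D $$ (k, 0)) = (\<Sum>k\<in>{0}. P $$ (i, k) * D $$ (k, 0))"
        using that by (intro sum.mono_neutral_right) (auto simp: D0)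
      then have "(C *\<^sub>v x) $ i = (\<Sum>k\<in>{0}. P $$ (i, k) * D $$ (k, 0))"
        using colmul[OF i, of 0] that by (simp add: x_def)
      then show "(C *\<^sub>v x) $ i = (es ! 0 \<cdot>\<^sub>v x) $ i" using i xy D PQ(5) that by (simp add: x_def)
    qed (use xy C in auto)
    have Cy: "C *\<^sub>v y = es ! 1 \<cdot>\<^sub>v y + D $$ (0, 1) \<cdot>\<^sub>v x"
    proof (rule eq_vecI)
      fix i assume "i < dim_vec (es ! 1 \<cdot>\<^sub>v y + D $$ (0, 1) \<cdot>\<^sub>v x)"
      then have i: "i < n" using xy by auto
      have "(\<Sum>k\<in>{0..<n}. P $$ (i, k) * D $$ (k, 1)) = (\<Sum>k\<in>{0, 1}. P $$ (i, k) * D $$ (k, 1))"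
        using that by (intro sum.mono_neutral_right) (auto simp: D0)
      then have "(C *\<^sub>v y) $ i = (\<Sum>k\<in>{0, 1}. P $$ (i, k) * D $$ (k, 1))"
        using colmul[OF i, of 1] that by (simp add: y_def)
      then show "(C *\<^sub>v y) $ i = (es ! 1 \<cdot>\<^sub>v y + D $$ (0, 1) \<cdot>\<^sub>v x) $ i"
        using i xy D PQ(5) that by (simp add: x_def y_def)
    qed (use xy C in auto)
    have ind: "a = 0 \<and> b = 0" if z: "\<forall>v\<in>A. a * fn x v + b * fn y v = 0" for a b
    proof -
      have z': "a * P $$ (i, 0) + b * P $$ (i, 1) = 0" if "i < n" for i
        using z[rule_format, OF eA[OF that]] that \<open>2 \<le> n\<close> PQ(5) de by (simp add: fn_def x_def y_def)
      \<comment> \<open>Multiplying the relation between \<open>x\<close> and \<open>y\<close> by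
        \<open>Q\<close>, the inverse of \<open>P\<close>, turns these columns into the first two
        unit vectors.\<close>
      have "a * (if k = 0 then 1 else 0) + b * (if k = 1 then 1 else 0) = 0" if k: "k < n" for k
      proof -
        have "(Q * P) $$ (k, 0) = (\<Sum>i\<in>{0..<n}. Q $$ (k, i) * P $$ (i, 0))"
          "(Q * P) $$ (k, 1) = (\<Sum>i\<in>{0..<n}. Q $$ (k, i) * P $$ (i, 1))"
          using k \<open>2 \<le> n\<close> PQ(5,6) by (auto simp: scalar_prod_def)
        then have "a * (Q * P) $$ (k, 0) + b * (Q * P) $$ (k, 1)
            = (\<Sum>i\<in>{0..<n}. Q $$ (k, i) * (a * P $$ (i, 0) + b * P $$ (i, 1)))"
          by (simp add: sum_distrib_left sum.distrib algebra_simps)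
        also have "\<dots> = 0" using z' by simp
        finally show ?thesis using k \<open>2 \<le> n\<close> unfolding PQ by simp
      qed
      from this[of 0] this[of 1] \<open>2 \<le> n\<close> show ?thesis by auto
    qed
    have xnz: "\<exists>v\<in>A. fn x v \<noteq> 0" using ind[of 1 0] by auto
    have "indep2 A (fn x) (fn y)" unfolding indep2_def using ind by blast
    moreover have "eigenpair A K (es ! 0, fn x)"
      using mulC[OF xy(1)] xnz xy dn unfolding eigenpair_def Cx by (simp add: fn_def)
    moreover have "\<forall>w\<in>A. (\<Sum>v\<in>A. of_int (K w v) * fn y v) = es ! 1 * fn y w + D $$ (0, 1) * fn x w"
      using mulC[OF xy(2)] xy dn unfolding Cy by (simp add: fn_def)
    ultimately
    show ?thesis by blast
  qed
  ultimately show ?thesis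
    using prod es(2) n_def by (intro exI[of _ evs]) (auto simp: evs_def comp_def)
qed

section \<open>Cocycles on right-angled Artin groups\<close>

text \<open>An interface to the Artin group without words: \<open>ex v\<close> is the exponent sum
  of the generator \<open>v\<close>, and \<open>cocycle_exists\<close> supplies a crossed
  homomorphism into the power series, on which \<open>g\<close> acts through multiplication by
  \<open>exp(t \<alpha>(g))\<close>.\<close>

locale raag_group = group G for G (structure) +
  fixes V :: "'v set" and adj :: "'v \<Rightarrow> 'v \<Rightarrow> bool"
    and gen :: "'v \<Rightarrow> 'a" and ex :: "'v \<Rightarrow> 'a \<Rightarrow> int"
  assumes finite_V: "finite V"
    and adj_sym: "adj v w \<Longrightarrow> adj w v"
    and adj_irrefl: "\<not> adj v v"
    and gen_closed: "v \<in> V \<Longrightarrow> gen v \<in> carrier G"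
    and generated: "carrier G = generate G (gen ` V)"
    and gen_commute: "\<lbrakk>v \<in> V; w \<in> V; adj v w\<rbrakk> \<Longrightarrow> gen v \<otimes> gen w = gen w \<otimes> gen v"
    and ex_mult: "\<lbrakk>g \<in> carrier G; h \<in> carrier G\<rbrakk> \<Longrightarrow> ex v (g \<otimes> h) = ex v g + ex v h"
    and ex_gen: "\<lbrakk>v \<in> V; w \<in> V\<rbrakk> \<Longrightarrow> ex v (gen w) = (if v = w then 1 else 0)"
    and cocycle_exists: "(\<And>v w. \<lbrakk>v \<in> V; w \<in> V; adj v w\<rbrakk> \<Longrightarrow> \<alpha> v * \<beta> w = \<alpha> w * \<beta> v) \<Longrightarrow>
      \<exists>c. (\<forall>g\<in>carrier G. \<forall>h\<in>carrier G.
          c (g \<otimes> h) = c g + fps_exp (pairing V \<alpha> (\<lambda>v. of_int (ex v g))) * c h)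
        \<and> (\<forall>v\<in>V. fps_nth (c (gen v)) 0 = \<beta> v)"

text \<open>The series \<open>(exp(aX) - 1) / (aX)\<close>, given by its coefficients so that the
  case \<open>a = 0\<close> is covered, where it is 1.\<close>

definition exp_quotient :: "complex \<Rightarrow> complex fps" where
  "exp_quotient a = Abs_fps (\<lambda>i. a ^ i / fact (Suc i))"

lemma exp_quotient: "fps_exp a - 1 = fps_const a * (fps_X * exp_quotient a)"
proof (rule fps_ext)
  fix n
  show "fps_nth (fps_exp a - 1) n = fps_nth (fps_const a * (fps_X * exp_quotient a)) n"
    by (cases n) (auto simp: exp_quotient_def simp del: fact_Suc)
qed

definition exponent :: "'v \<Rightarrow> 'v word \<Rightarrow> int" where
  "exponent v w = (\<Sum>(s, b)\<leftarrow>w. if s = v then (if b then 1 else -1) else 0)"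

primrec word_char :: "('v \<Rightarrow> complex) \<Rightarrow> 'v word \<Rightarrow> complex" where
  "word_char \<alpha> [] = 0"
| "word_char \<alpha> (x # w) = (if snd x then \<alpha> (fst x) else - \<alpha> (fst x)) + word_char \<alpha> w"

text \<open>On a generator \<open>s\<close> the constant term is \<open>\<beta>(s)\<close>, and the
  factor \<open>exp_quotient\<close> is what makes the commutator relations hold. The value on the
  inverse letter is forced by the cocycle law applied to the product of \<open>s\<close> and its
  inverse.\<close>

definition letter_cocycle :: "('v \<Rightarrow> complex) \<Rightarrow> ('v \<Rightarrow> complex) \<Rightarrow> 'v \<times> bool \<Rightarrow> complex fps" where
  "letter_cocycle \<alpha> \<beta> x = (let c = fps_const (\<beta> (fst x)) * exp_quotient (\<alpha> (fst x))
     in if snd x then c else - fps_exp (- \<alpha> (fst x)) * c)"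

primrec word_cocycle :: "('v \<Rightarrow> complex) \<Rightarrow> ('v \<Rightarrow> complex) \<Rightarrow> 'v word \<Rightarrow> complex fps" where
  "word_cocycle \<alpha> \<beta> [] = 0"
| "word_cocycle \<alpha> \<beta> (x # w) = letter_cocycle \<alpha> \<beta> x + fps_exp (word_char \<alpha> [x]) * word_cocycle \<alpha> \<beta> w"

lemma exponent_append: "exponent v (u @ w) = exponent v u + exponent v w"
  by (simp add: exponent_def)

lemma word_char_append: "word_char \<alpha> (u @ w) = word_char \<alpha> u + word_char \<alpha> w"
  by (induction u) auto

lemma word_cocycle_append:
  "word_cocycle \<alpha> \<beta> (u @ w) = word_cocycle \<alpha> \<beta> u + fps_exp (word_char \<alpha> u) * word_cocycle \<alpha> \<beta> w"
  by (induction u) (auto simp: algebra_simps fps_exp_add_mult)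

lemma word_char_eq:
  assumes "finite V" "w \<in> words V"
  shows "word_char \<alpha> w = pairing V \<alpha> (\<lambda>v. of_int (exponent v w))"
  using assms(2)
proof (induction w)
  case (Cons x w)
  have "pairing V \<alpha> (\<lambda>v. of_int (exponent v (x # w)))
      = (\<Sum>v\<in>V. (if v = fst x then (if snd x then \<alpha> v else - \<alpha> v) else 0) + \<alpha> v * of_int (exponent v w))"
    unfolding pairing_def exponent_def by (rule sum.cong) (auto simp: algebra_simps split: prod.splits)
  also have "\<dots> = word_char \<alpha> (x # w)"
    using Cons assms(1) by (auto simp: sum.distrib pairing_def)
  finally show ?case by simp
qed (simp add: pairing_def exponent_def)

lemma fps_exp_cancel: "fps_exp (a::complex) * (fps_exp (- a) * f) = f" "fps_exp (- a) * (fps_exp a * f) = f"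
  by (simp_all add: fps_exp_add_mult[symmetric] mult.assoc[symmetric])

section \<open>Invariance under the defining relations\<close>

context
  fixes V :: "'v set" and adj :: "'v \<Rightarrow> 'v \<Rightarrow> bool" and R
  assumes R_def: "R = {commutator_word v w |v w. v \<in> V \<and> w \<in> V \<and> adj v w}"
begin

lemma exponent_invariant: "(u, w) \<in> presentation_rel V R \<Longrightarrow> exponent v u = exponent v w"
  by (induction rule: presentation_rel.induct)
    (auto simp: exponent_append R_def commutator_word_def exponent_def)

text \<open>By the cocycle law, vanishing on a commutator relator amounts to
  \<open>(exp a - 1) B = (exp b - 1) A\<close>. With the chosen letter values both sides are scalar
  multiples of \<open>X exp_quotient a exp_quotient b\<close>, and the scalars
  \<open>a \<beta>(y)\<close> and \<open>b \<beta>(x)\<close> agree by hypothesis.\<close>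

lemma word_cocycle_invariant:
  assumes "\<And>v w. \<lbrakk>v \<in> V; w \<in> V; adj v w\<rbrakk> \<Longrightarrow> \<alpha> v * \<beta> w = \<alpha> w * \<beta> v"
  shows "(u, w) \<in> presentation_rel V R \<Longrightarrow> word_cocycle \<alpha> \<beta> u = word_cocycle \<alpha> \<beta> w"
proof (induction rule: presentation_rel.induct)
  case (cancel u w s b)
  then show ?case
    by (cases b) (auto simp: word_cocycle_append word_char_append letter_cocycle_def Let_def fps_exp_cancel algebra_simps)
next
  case (relator u w r)
  then obtain x y where r: "r = commutator_word x y" and xy: "\<alpha> x * \<beta> y = \<alpha> y * \<beta> x"
    using assms by (auto simp: R_def)
  define a b where "a = \<alpha> x" and "b = \<alpha> y"
  define A B where "A = fps_const (\<beta> x) * exp_quotient a" and "B = fps_const (\<beta> y) * exp_quotient b"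
  have "(fps_exp a - 1) * B = (fps_exp b - 1) * A"
  proof -
    have "(fps_exp a - 1) * B = fps_const (a * \<beta> y) * (fps_X * exp_quotient a * exp_quotient b)"
      unfolding exp_quotient B_def by (simp add: algebra_simps fps_const_mult[symmetric] del: fps_const_mult)
    also have "\<dots> = fps_const (b * \<beta> x) * (fps_X * exp_quotient a * exp_quotient b)"
      using xy by (simp add: a_def b_def)
    also have "\<dots> = (fps_exp b - 1) * A"
      unfolding exp_quotient A_def by (simp add: algebra_simps fps_const_mult[symmetric] del: fps_const_mult)
    finally show ?thesis .
  qed
  then have eq: "fps_exp a * B - B = fps_exp b * A - A" by (simp add: algebra_simps)
  have 1: "fps_exp a * (fps_exp b * (fps_exp (- a) * f)) = fps_exp b * f" for f
    by (metis fps_exp_cancel(1) mult.left_commute)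
  have "word_cocycle \<alpha> \<beta> r = A + fps_exp a * (B + fps_exp b * (- fps_exp (- a) * A
      + fps_exp (- a) * (- fps_exp (- b) * B)))"
    by (simp add: r commutator_word_def letter_cocycle_def a_def[symmetric] b_def[symmetric]
        A_def[symmetric] B_def[symmetric])
  also have "\<dots> = A + fps_exp a * B - fps_exp a * (fps_exp b * (fps_exp (- a) * A))
     - fps_exp a * (fps_exp b * (fps_exp (- a) * (fps_exp (- b) * B)))"
    by (simp add: algebra_simps)
  also have "\<dots> = 0" unfolding 1 fps_exp_cancel using eq by (simp add: algebra_simps)
  finally have "word_cocycle \<alpha> \<beta> r = 0" .
  moreover have "word_char \<alpha> r = 0" by (simp add: r commutator_word_def)
  ultimately show ?case by (simp add: word_cocycle_append word_char_append)
qed auto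

text \<open>Exponent sums and cocycles are evaluated at a chosen representative \<open>rep\<close>
  of a class. The invariance lemmas make the choice immaterial, so the formulas for concatenated
  words carry over to products.\<close>

lemma raag_group_presented:
  assumes "finite V" and sym: "\<And>v w. adj v w \<Longrightarrow> adj w v" and irr: "\<And>v. \<not> adj v v"
  shows "\<exists>gen ex. raag_group (presented_group V R) V adj gen ex"
proof -
  let ?G = "presented_group V R" and ?c = "\<lambda>w. presentation_rel V R `` {w}"
  have R: "R \<subseteq> words V" by (auto simp: R_def commutator_word_def)
  note eq = equiv_presentation_rel[OF R] and mult = presented_group_mult[OF R]
  interpret group ?G by (rule group_presented_group[OF R])
  have car: "carrier ?G = ?c ` words V" and one: "\<one>\<^bsub>?G\<^esub> = ?c []"
    by (auto simp: presented_group_def quotient_def)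
  define rep where "rep X = (SOME w. w \<in> X)" for X :: "'v word set"
  have rep: "(w, rep (?c w)) \<in> presentation_rel V R" if "w \<in> words V" for w
  proof -
    have "w \<in> ?c w" using that by (auto intro: presentation_rel.refl)
    then have "rep (?c w) \<in> ?c w" unfolding rep_def by (rule someI)
    then show ?thesis by auto
  qed
  define gen where "gen v = ?c [(v, True)]" for v
  define ex where "ex v X = exponent v (rep X)" for v X
  have ex: "ex v (?c w) = exponent v w" if "w \<in> words V" for v w
    unfolding ex_def using exponent_invariant[OF rep[OF that]] by simp
  have gen_closed: "gen v \<in> carrier ?G" if "v \<in> V" for v
    using that by (auto simp: car gen_def)
  have "raag_group ?G V adj gen ex"
  proof
    show "finite V" by fact
    show "adj v w \<Longrightarrow> adj w v" for v w by (rule sym)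
    show "\<not> adj v v" for v by (rule irr)
    show "v \<in> V \<Longrightarrow> gen v \<in> carrier ?G" for v by (rule gen_closed)
    show "carrier ?G = generate ?G (gen ` V)"
    proof
      show "generate ?G (gen ` V) \<subseteq> carrier ?G"
        using gen_closed by (intro generate_incl) auto
      have "?c w \<in> generate ?G (gen ` V)" if "w \<in> words V" for w
        using that
      proof (induction w)
        case Nil
        show ?case unfolding one[symmetric] by (rule generate.one)
      next
        case (Cons x w)
        obtain s b where x: "x = (s, b)" by (cases x)
        have s: "s \<in> V" and w: "w \<in> words V" using Cons x by auto
        have "?c [(s, False)] \<otimes>\<^bsub>?G\<^esub> gen s = \<one>\<^bsub>?G\<^esub>"
        proof -
          have "([] @ [(s, False), (s, \<not> False)] @ [], [] @ []) \<in> presentation_rel V R"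
            using s by (intro presentation_rel.cancel) auto
          then have "?c [(s, False), (s, True)] = ?c []" using equiv_class_eq[OF eq] by simp
          then show ?thesis using s unfolding gen_def one by (subst mult) auto
        qed
        then have inv: "inv\<^bsub>?G\<^esub> (gen s) = ?c [(s, False)]"
          using s gen_closed by (intro inv_equality) (auto simp: car)
        have "?c [x] \<in> generate ?G (gen ` V)"
        proof (cases b)
          case True
          then show ?thesis using s x by (auto simp: gen_def[symmetric] intro: generate.incl)
        next
          case False
          then have "?c [x] = inv\<^bsub>?G\<^esub> (gen s)" using inv x by simp
          then show ?thesis using s by (auto intro: generate.inv)
        qed
        moreover have "?c (x # w) = ?c [x] \<otimes>\<^bsub>?G\<^esub> ?c w"
          using s w x by (subst mult) auto
        ultimately show ?case using Cons by (auto intro: generate.eng)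
      qed
      then show "carrier ?G \<subseteq> generate ?G (gen ` V)" by (auto simp: car)
    qed
    show "gen v \<otimes>\<^bsub>?G\<^esub> gen w = gen w \<otimes>\<^bsub>?G\<^esub> gen v" if "v \<in> V" "w \<in> V" "adj v w" for v w
    proof -
      let ?r = "presentation_rel V R"
      have "([] @ commutator_word v w @ [(w, True), (v, True)], [] @ [(w, True), (v, True)]) \<in> ?r"
        using that by (intro presentation_rel.relator) (auto simp: R_def)
      then have 1: "([(v, True), (w, True), (v, False), (w, False), (w, True), (v, True)], [(w, True), (v, True)]) \<in> ?r"
        by (simp add: commutator_word_def)
      have "([(v, True), (w, True), (v, False)] @ [(w, False), (w, \<not> False)] @ [(v, True)],
          [(v, True), (w, True), (v, False)] @ [(v, True)]) \<in> ?r"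
        using that by (intro presentation_rel.cancel) auto
      then have 2: "([(v, True), (w, True), (v, False), (w, False), (w, True), (v, True)],
          [(v, True), (w, True), (v, False), (v, True)]) \<in> ?r" by simp
      have "([(v, True), (w, True)] @ [(v, False), (v, \<not> False)] @ [],
          [(v, True), (w, True)] @ []) \<in> ?r"
        using that by (intro presentation_rel.cancel) auto
      then have 3: "([(v, True), (w, True), (v, False), (v, True)], [(v, True), (w, True)]) \<in> ?r" by simp
      have "([(v, True), (w, True)], [(w, True), (v, True)]) \<in> ?r"
        using presentation_rel.trans[OF presentation_rel.sym[OF presentation_rel.trans[OF 2 3]] 1] .
      then have "?c [(v, True), (w, True)] = ?c [(w, True), (v, True)]" by (rule equiv_class_eq[OF eq])
      then show ?thesis using that by (simp add: gen_def mult)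
    qed
    show "ex v (g \<otimes>\<^bsub>?G\<^esub> h) = ex v g + ex v h" if gh: "g \<in> carrier ?G" "h \<in> carrier ?G" for v g h
    proof -
      obtain u w where "u \<in> words V" "w \<in> words V" "g = ?c u" "h = ?c w"
        using gh unfolding car by blast
      then show ?thesis by (simp add: mult ex exponent_append)
    qed
    show "ex v (gen w) = (if v = w then 1 else 0)" if "v \<in> V" "w \<in> V" for v w
      using that by (simp add: gen_def ex exponent_def)
    fix \<alpha> \<beta> :: "'v \<Rightarrow> complex"
    assume perp: "\<And>v w. \<lbrakk>v \<in> V; w \<in> V; adj v w\<rbrakk> \<Longrightarrow> \<alpha> v * \<beta> w = \<alpha> w * \<beta> v"
    define c where "c X = word_cocycle \<alpha> \<beta> (rep X)" for X
    have c: "c (?c w) = word_cocycle \<alpha> \<beta> w" if "w \<in> words V" for w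
      unfolding c_def using word_cocycle_invariant[OF perp rep[OF that]] by simp
    have "c (g \<otimes>\<^bsub>?G\<^esub> h) = c g + fps_exp (pairing V \<alpha> (\<lambda>v. of_int (ex v g))) * c h"
      if gh: "g \<in> carrier ?G" "h \<in> carrier ?G" for g h
    proof -
      obtain u w where "u \<in> words V" "w \<in> words V" "g = ?c u" "h = ?c w"
        using gh unfolding car by blast
      then show ?thesis
        using assms(1) by (simp add: mult ex c word_cocycle_append word_char_eq)
    qed
    moreover have "fps_nth (c (gen v)) 0 = \<beta> v" if "v \<in> V" for v
      using that by (simp add: gen_def c letter_cocycle_def exp_quotient_def)
    ultimately show "\<exists>c. (\<forall>g\<in>carrier ?G. \<forall>h\<in>carrier ?G.
          c (g \<otimes>\<^bsub>?G\<^esub> h) = c g + fps_exp (pairing V \<alpha> (\<lambda>v. of_int (ex v g))) * c h)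
        \<and> (\<forall>v\<in>V. fps_nth (c (gen v)) 0 = \<beta> v)" by blast
  qed
  then show ?thesis by blast
qed

end

section \<open>Homomorphisms, cup products and cocycles on the group\<close>

context raag_group
begin

definition hom_of :: "('v \<Rightarrow> complex) \<Rightarrow> 'a \<Rightarrow> complex" where
  "hom_of \<alpha> g = pairing V \<alpha> (\<lambda>v. of_int (ex v g))"

definition perp :: "('v \<Rightarrow> complex) \<Rightarrow> ('v \<Rightarrow> complex) \<Rightarrow> bool" where
  "perp \<alpha> \<beta> \<longleftrightarrow> (\<forall>v\<in>V. \<forall>w\<in>V. adj v w \<longrightarrow> \<alpha> v * \<beta> w = \<alpha> w * \<beta> v)"

definition cocycle :: "('v \<Rightarrow> complex) \<Rightarrow> ('a \<Rightarrow> complex fps) \<Rightarrow> bool" where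
  "cocycle \<alpha> c \<longleftrightarrow> (\<forall>g\<in>carrier G. \<forall>h\<in>carrier G. c (g \<otimes> h) = c g + fps_exp (hom_of \<alpha> g) * c h)"

text \<open>The homomorphism belonging to \<open>\<alpha>\<close>, composed with
  \<open>\<phi>\<close> and encoded again by its values on the generators. It is contravariant in
  \<open>\<phi>\<close>.\<close>

definition pullback :: "('a \<Rightarrow> 'a) \<Rightarrow> ('v \<Rightarrow> complex) \<Rightarrow> 'v \<Rightarrow> complex" where
  "pullback \<phi> \<alpha> v = hom_of \<alpha> (\<phi> (gen v))"

lemma hom_of_mult: "\<lbrakk>g \<in> carrier G; h \<in> carrier G\<rbrakk> \<Longrightarrow> hom_of \<alpha> (g \<otimes> h) = hom_of \<alpha> g + hom_of \<alpha> h"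
  by (simp add: hom_of_def pairing_def ex_mult sum.distrib algebra_simps)

lemma hom_of_gen: "v \<in> V \<Longrightarrow> hom_of \<alpha> (gen v) = \<alpha> v"
  using finite_V by (simp add: hom_of_def pairing_def ex_gen if_distrib[of "\<lambda>x. _ * of_int x"] cong: if_cong)

lemma ex_one: "ex v \<one> = 0"
  using ex_mult[of \<one> \<one> v] by simp

lemma ex_inv: "g \<in> carrier G \<Longrightarrow> ex v (inv g) = - ex v g"
  using ex_mult[of g "inv g" v] by (simp add: ex_one)

lemma hom_of_one: "hom_of \<alpha> \<one> = 0"
  by (simp add: hom_of_def pairing_def ex_one)

lemma hom_of_inv: "g \<in> carrier G \<Longrightarrow> hom_of \<alpha> (inv g) = - hom_of \<alpha> g"
  by (simp add: hom_of_def pairing_def ex_inv sum_negf)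

lemma additive_eq_hom_of:
  assumes add: "\<And>g h. \<lbrakk>g \<in> carrier G; h \<in> carrier G\<rbrakk> \<Longrightarrow> f (g \<otimes> h) = f g + (f h :: complex)"
    and "g \<in> carrier G"
  shows "f g = hom_of (\<lambda>v. f (gen v)) g"
proof -
  have one: "f \<one> = 0" using add[of \<one> \<one>] by simp
  have "g \<in> generate G (gen ` V)" using assms(2) generated by simp
  then show ?thesis
  proof (induction rule: generate.induct)
    case one
    show ?case by (simp add: \<open>f \<one> = 0\<close> hom_of_one)
  next
    case (incl h)
    then show ?case by (auto simp: hom_of_gen)
  next
    case (inv h)
    then obtain v where v: "v \<in> V" "h = gen v" by auto
    then have "f (inv h) = - f h"
      using add[of h "inv h"] gen_closed one by (simp add: eq_neg_iff_add_eq_0 add.commute)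
    then show ?case using v gen_closed by (simp add: hom_of_inv hom_of_gen)
  next
    case (eng h1 h2)
    then have "h1 \<in> carrier G" "h2 \<in> carrier G" by (simp_all add: generated)
    then show ?case using eng by (simp add: add hom_of_mult)
  qed
qed

lemma cocycle_one:
  assumes "cocycle \<alpha> c"
  shows "c \<one> = 0"
proof -
  have "c (\<one> \<otimes> \<one>) = c \<one> + fps_exp (hom_of \<alpha> \<one>) * c \<one>"
    using assms unfolding cocycle_def by blast
  then show ?thesis by (simp add: hom_of_one)
qed

lemma cocycle_nth_0:
  assumes "cocycle \<alpha> c" "g \<in> carrier G"
  shows "fps_nth (c g) 0 = hom_of (\<lambda>v. fps_nth (c (gen v)) 0) g"
  using assms unfolding cocycle_def
  by (intro additive_eq_hom_of[where f = "\<lambda>g. fps_nth (c g) 0"]) auto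

lemma perp_cocycle:
  assumes "perp \<alpha> \<beta>"
  shows "\<exists>c. cocycle \<alpha> c \<and> (\<forall>g\<in>carrier G. fps_nth (c g) 0 = hom_of \<beta> g)"
proof -
  obtain c where c: "cocycle \<alpha> c" "\<forall>v\<in>V. fps_nth (c (gen v)) 0 = \<beta> v"
    using cocycle_exists[of \<alpha> \<beta>] assms unfolding perp_def cocycle_def hom_of_def by blast
  moreover have "hom_of (\<lambda>v. fps_nth (c (gen v)) 0) g = hom_of \<beta> g" for g
    using c(2) by (simp add: hom_of_def pairing_def)
  ultimately show ?thesis using cocycle_nth_0[OF c(1)] by (intro exI[of _ c]) simp
qed

text \<open>The right-hand side does not mention generators, which makes \<open>perp\<close> stable
  under endomorphisms. In one direction \<open>b\<close> is the coefficient of index 1 of the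
  cocycle; the other compares the two products of commuting generators.\<close>

lemma perp_iff:
  "perp \<alpha> \<beta> \<longleftrightarrow> (\<exists>b. \<forall>g\<in>carrier G. \<forall>h\<in>carrier G. b (g \<otimes> h) = b g + b h + hom_of \<alpha> g * hom_of \<beta> h)"
proof
  assume "perp \<alpha> \<beta>"
  then obtain c where c: "cocycle \<alpha> c" "\<forall>g\<in>carrier G. fps_nth (c g) 0 = hom_of \<beta> g"
    using perp_cocycle by blast
  show "\<exists>b. \<forall>g\<in>carrier G. \<forall>h\<in>carrier G. b (g \<otimes> h) = b g + b h + hom_of \<alpha> g * hom_of \<beta> h"
    using c by (intro exI[of _ "\<lambda>g. fps_nth (c g) 1"]) (simp add: cocycle_def fps_mult_nth)
next
  assume "\<exists>b. \<forall>g\<in>carrier G. \<forall>h\<in>carrier G. b (g \<otimes> h) = b g + b h + hom_of \<alpha> g * hom_of \<beta> h"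
  then obtain b where
    b: "\<And>g h. \<lbrakk>g \<in> carrier G; h \<in> carrier G\<rbrakk> \<Longrightarrow> b (g \<otimes> h) = b g + b h + hom_of \<alpha> g * hom_of \<beta> h"
    by blast
  show "perp \<alpha> \<beta>"
    unfolding perp_def
  proof (intro ballI impI)
    fix v w assume "v \<in> V" "w \<in> V" "adj v w"
    then show "\<alpha> v * \<beta> w = \<alpha> w * \<beta> v"
      using b[of "gen v" "gen w"] b[of "gen w" "gen v"] gen_commute[of v w] gen_closed by (simp add: hom_of_gen)
  qed
qed

lemma hom_of_pullback:
  assumes "\<phi> \<in> hom G G" "g \<in> carrier G"
  shows "hom_of (pullback \<phi> \<alpha>) g = hom_of \<alpha> (\<phi> g)"
proof -
  have "hom_of \<alpha> (\<phi> g) = hom_of (\<lambda>v. hom_of \<alpha> (\<phi> (gen v))) g"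
    using assms by (intro additive_eq_hom_of[where f = "\<lambda>g. hom_of \<alpha> (\<phi> g)"])
      (auto simp: hom_mult hom_in_carrier hom_of_mult)
  then show ?thesis by (simp add: pullback_def[abs_def])
qed

lemma cocycle_comp:
  assumes "\<phi> \<in> hom G G" "cocycle \<alpha> c"
  shows "cocycle (pullback \<phi> \<alpha>) (\<lambda>g. c (\<phi> g))"
  using assms unfolding cocycle_def by (simp add: hom_of_pullback hom_mult hom_in_carrier)

lemma perp_pullback:
  assumes "\<phi> \<in> hom G G" "perp \<alpha> \<beta>"
  shows "perp (pullback \<phi> \<alpha>) (pullback \<phi> \<beta>)"
proof -
  obtain b where "\<forall>g\<in>carrier G. \<forall>h\<in>carrier G. b (g \<otimes> h) = b g + b h + hom_of \<alpha> g * hom_of \<beta> h"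
    using assms(2) perp_iff by blast
  then show ?thesis unfolding perp_iff using assms(1)
    by (intro exI[of _ "\<lambda>g. b (\<phi> g)"]) (simp add: hom_of_pullback hom_mult hom_in_carrier)
qed

lemma hom_funpow: "\<phi> \<in> hom G G \<Longrightarrow> (\<phi> ^^ i) \<in> hom G G"
  by (induction i) (auto simp: hom_def Pi_iff)

lemma pullback_comp:
  assumes "\<phi> \<in> hom G G" "\<psi> \<in> hom G G" "v \<in> V"
  shows "pullback \<psi> (pullback \<phi> \<alpha>) v = pullback (\<phi> \<circ> \<psi>) \<alpha> v"
  using assms gen_closed by (simp add: pullback_def[of _ _ v] hom_of_pullback hom_in_carrier)

text \<open>Polynomial functions on the group of degree at most the given number, in the sense of
  iterated left differences.\<close>

primrec poly_le :: "nat \<Rightarrow> ('a \<Rightarrow> complex) \<Rightarrow> bool" where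
  "poly_le 0 p \<longleftrightarrow> (\<exists>a. \<forall>g\<in>carrier G. p g = a)"
| "poly_le (Suc k) p \<longleftrightarrow> (\<forall>g\<in>carrier G. poly_le k (\<lambda>h. p (g \<otimes> h) - p h))"

lemma poly_le_cong: "(\<And>g. g \<in> carrier G \<Longrightarrow> p g = q g) \<Longrightarrow> poly_le k p = poly_le k q"
proof (induction k arbitrary: p q)
  case (Suc k)
  have "poly_le k (\<lambda>h. p (g \<otimes> h) - p h) = poly_le k (\<lambda>h. q (g \<otimes> h) - q h)" if "g \<in> carrier G" for g
    by (rule Suc.IH) (use that Suc.prems in simp)
  then show ?case by simp
qed simp

lemma poly_le_transfer: "poly_le k p \<Longrightarrow> (\<And>g. g \<in> carrier G \<Longrightarrow> q g = p g) \<Longrightarrow> poly_le k q"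
  using poly_le_cong[of p q k] by simp

lemma poly_le_const: "poly_le k (\<lambda>_. a)"
  by (induction k arbitrary: a) auto

lemma poly_le_Suc: "poly_le k p \<Longrightarrow> poly_le (Suc k) p"
proof (induction k arbitrary: p)
  case 0
  then have "poly_le 0 (\<lambda>h. p (g \<otimes> h) - p h)" if "g \<in> carrier G" for g
    using that by auto
  then show ?case by simp
next
  case (Suc k)
  have "poly_le (Suc k) (\<lambda>h. p (g \<otimes> h) - p h)" if "g \<in> carrier G" for g
    using Suc.prems that by (intro Suc.IH) simp
  then show ?case by (subst poly_le.simps) blast
qed


lemma poly_le_mono: "k \<le> l \<Longrightarrow> poly_le k p \<Longrightarrow> poly_le l p"
  by (induction rule: dec_induct) (use poly_le_Suc in auto)

lemma poly_le_add: "poly_le k p \<Longrightarrow> poly_le k q \<Longrightarrow> poly_le k (\<lambda>g. p g + q g)"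
proof (induction k arbitrary: p q)
  case (Suc k)
  have "poly_le k (\<lambda>h. (p (g \<otimes> h) - p h) + (q (g \<otimes> h) - q h))" if "g \<in> carrier G" for g
    using Suc that by simp
  then show ?case by (simp add: algebra_simps)
qed (simp, metis)

lemma poly_le_cmult: "poly_le k p \<Longrightarrow> poly_le k (\<lambda>g. a * p g)"
proof (induction k arbitrary: p)
  case (Suc k)
  have "poly_le k (\<lambda>h. a * (p (g \<otimes> h) - p h))" if "g \<in> carrier G" for g
    using Suc that by simp
  then show ?case by (simp add: algebra_simps)
qed (simp, metis)

lemma poly_le_sum: "(\<And>i. i \<in> I \<Longrightarrow> poly_le k (p i)) \<Longrightarrow> poly_le k (\<lambda>g. \<Sum>i\<in>I. p i g)"
  by (induction I rule: infinite_finite_induct) (auto simp: poly_le_const poly_le_add)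

lemma poly_le_comp:
  assumes "\<phi> \<in> hom G G"
  shows "poly_le k p \<Longrightarrow> poly_le k (\<lambda>g. p (\<phi> g))"
proof (induction k arbitrary: p)
  case 0
  then show ?case using hom_in_carrier[OF assms] by auto
next
  case (Suc k)
  have "poly_le k (\<lambda>h. p (\<phi> (g \<otimes> h)) - p (\<phi> h))" if "g \<in> carrier G" for g
  proof -
    have "poly_le k (\<lambda>h. p (\<phi> g \<otimes> h) - p h)" using Suc.prems assms that by (simp add: hom_in_carrier)
    then have "poly_le k (\<lambda>h. p (\<phi> g \<otimes> \<phi> h) - p (\<phi> h))" by (rule Suc.IH)
    then show ?thesis by (rule poly_le_transfer) (use assms that in \<open>simp add: hom_mult\<close>)
  qed
  then show ?case by simp
qed

lemma poly_le_hom_of: "poly_le (Suc 0) (hom_of \<alpha>)"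
  by (simp add: hom_of_mult hom_of_one)

text \<open>In the difference of the coefficients of \<open>c(gh)\<close> and \<open>c(h)\<close>
  the constant term 1 of the exponential cancels. For fixed \<open>g\<close> there remain a constant
  and coefficients of \<open>c(h)\<close> of index below \<open>k\<close>, which the induction
  covers.\<close>

lemma poly_le_cocycle_nth:
  assumes "cocycle \<alpha> c"
  shows "poly_le (Suc k) (\<lambda>g. fps_nth (c g) k)"
proof (induction k rule: less_induct)
  case (less k)
  have "poly_le k (\<lambda>h. fps_nth (c (g \<otimes> h)) k - fps_nth (c h) k)" if g: "g \<in> carrier G" for g
  proof -
    have "poly_le k (\<lambda>h. fps_nth (c g) k + (\<Sum>i\<in>{1..k}. fps_nth (fps_exp (hom_of \<alpha> g)) i * fps_nth (c h) (k - i)))"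
    proof (intro poly_le_add poly_le_const poly_le_sum poly_le_cmult)
      fix i assume "i \<in> {1..k}"
      then show "poly_le k (\<lambda>h. fps_nth (c h) (k - i))"
        using less[of "k - i"] by (intro poly_le_mono[of "Suc (k - i)" k]) auto
    qed
    moreover have "fps_nth (c (g \<otimes> h)) k - fps_nth (c h) k
        = fps_nth (c g) k + (\<Sum>i\<in>{1..k}. fps_nth (fps_exp (hom_of \<alpha> g)) i * fps_nth (c h) (k - i))"
      if "h \<in> carrier G" for h
    proof -
      have "fps_nth (fps_exp (hom_of \<alpha> g)) 0 = 1" by simp
      then show ?thesis using assms g that
        by (simp add: cocycle_def fps_mult_nth sum.atLeast_Suc_atMost[of 0 k] del: fps_exp_nth)
    qed
    ultimately show ?thesis by (rule poly_le_transfer)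
  qed
  then show ?case by simp
qed

lemma left_invariant_const:
  assumes "\<And>s h. \<lbrakk>s \<in> V; h \<in> carrier G\<rbrakk> \<Longrightarrow> p (gen s \<otimes> h) = p h" and "g \<in> carrier G"
  shows "p g = p \<one>"
proof -
  have "g \<in> generate G (gen ` V)" using assms(2) generated by simp
  then have "\<forall>h\<in>carrier G. p (g \<otimes> h) = p h"
  proof (induction rule: generate.induct)
    case (inv h)
    then obtain s where s: "s \<in> V" "h = gen s" by auto
    show ?case
    proof
      fix k assume k: "k \<in> carrier G"
      have "p (inv h \<otimes> k) = p (gen s \<otimes> (inv h \<otimes> k))"
        using s k gen_closed by (intro assms(1)[symmetric]) auto
      then show "p (inv h \<otimes> k) = p k" using s k gen_closed by (simp add: m_assoc[symmetric])
    qed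
  next
    case (eng h1 h2)
    then have "h1 \<in> carrier G" "h2 \<in> carrier G" by (simp_all add: generated)
    then show ?case using eng by (simp add: m_assoc)
  qed (use assms(1) in auto)
  from this[rule_format, of \<one>] assms(2) show ?thesis by simp
qed

text \<open>Finite-dimensionality of the polynomial functions of bounded degree, phrased as
  determination by finitely many values. If \<open>p\<close> vanishes on \<open>X\<close> and on the
  translates of \<open>X\<close> by generators, then its differences along generators have lower
  degree and vanish on \<open>X\<close>. So \<open>p\<close> is invariant under translation and
  equals its value at \<open>\<one>\<close>.\<close>

lemma poly_le_determined:
  "\<exists>X. finite X \<and> X \<subseteq> carrier G \<and>
    (\<forall>p. poly_le k p \<longrightarrow> (\<forall>x\<in>X. p x = 0) \<longrightarrow> (\<forall>g\<in>carrier G. p g = 0))"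
proof (induction k)
  case 0
  have "p g = 0" if "poly_le 0 p" "p \<one> = 0" "g \<in> carrier G" for p g
    using that by (metis poly_le.simps(1) one_closed)
  then show ?case by (intro exI[of _ "{\<one>}"]) simp
next
  case (Suc k)
  then obtain X where X: "finite X" "X \<subseteq> carrier G"
    "\<And>p. \<lbrakk>poly_le k p; \<forall>x\<in>X. p x = 0\<rbrakk> \<Longrightarrow> \<forall>g\<in>carrier G. p g = 0" by blast
  define Y where "Y = insert \<one> (X \<union> (\<Union>s\<in>V. (\<lambda>x. gen s \<otimes> x) ` X))"
  have "p g = 0" if p: "poly_le (Suc k) p" and y: "\<forall>x\<in>Y. p x = 0" and g: "g \<in> carrier G" for p g
  proof -
    have "p (gen s \<otimes> h) = p h" if s: "s \<in> V" and h: "h \<in> carrier G" for s h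
    proof -
      have "poly_le k (\<lambda>h. p (gen s \<otimes> h) - p h)" using p gen_closed[OF s] by simp
      moreover have "\<forall>x\<in>X. p (gen s \<otimes> x) - p x = 0" using y s by (auto simp: Y_def)
      ultimately have "\<forall>h\<in>carrier G. p (gen s \<otimes> h) - p h = 0" by (rule X(3))
      then show ?thesis using h by simp
    qed
    then have "p g = p \<one>" using g by (rule left_invariant_const)
    then show ?thesis using y by (simp add: Y_def)
  qed
  moreover have "finite Y" using X(1) finite_V by (simp add: Y_def)
  moreover have "Y \<subseteq> carrier G" using X(2) gen_closed by (auto simp: Y_def)
  ultimately show ?case by blast
qed

text \<open>One more iterate than there are points in \<open>X\<close> gives a linear relation on
  \<open>X\<close>. The combination still has degree at most \<open>k\<close>, so the relation holds
  on the whole group.\<close>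

lemma poly_le_dependent:
  assumes "\<phi> \<in> hom G G" "poly_le k f"
  shows "\<exists>p. p \<noteq> 0 \<and> (\<forall>x\<in>carrier G. iterate_comb \<phi> f p x = 0)"
proof -
  obtain X where X: "finite X" "X \<subseteq> carrier G"
    "\<And>p. \<lbrakk>poly_le k p; \<forall>x\<in>X. p x = 0\<rbrakk> \<Longrightarrow> \<forall>g\<in>carrier G. p g = 0"
    using poly_le_determined[of k] by blast
  obtain c where c: "\<exists>i\<in>{..card X}. c i \<noteq> 0" "\<forall>x\<in>X. (\<Sum>i\<in>{..card X}. c i * f ((\<phi> ^^ i) x)) = 0"
    using underdetermined_system[of X "{..card X}" "\<lambda>i x. f ((\<phi> ^^ i) x)"] X(1) by auto
  define p where "p = (\<Sum>i\<le>card X. monom (c i) i)"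
  have coeff: "coeff p i = (if i \<le> card X then c i else 0)" for i
    by (simp add: p_def coeff_sum)
  have "degree p \<le> card X" by (rule degree_le) (simp add: coeff)
  then have iterate_comb: "iterate_comb \<phi> f p x = (\<Sum>i\<le>card X. c i * f ((\<phi> ^^ i) x))" for x
    by (subst iterate_comb_eq) (auto simp: coeff)
  have "poly_le k (\<lambda>x. \<Sum>i\<le>card X. c i * f ((\<phi> ^^ i) x))"
    by (intro poly_le_sum poly_le_cmult poly_le_comp[OF hom_funpow[OF assms(1)] assms(2)])
  then have "\<forall>x\<in>carrier G. iterate_comb \<phi> f p x = 0" using X(3) c(2) unfolding iterate_comb by blast
  moreover have "p \<noteq> 0" using c(1) coeff by (metis atMost_iff coeff_0)
  ultimately show ?thesis by blast
qed

end

section \<open>Automorphisms and twin classes\<close>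

context raag_group
begin

text \<open>The inverse \<open>\<psi>\<close> is carried along, and both identities are required on
  the carrier only, since elements of \<open>auto G\<close> are \<open>undefined\<close>
  elsewhere.\<close>

definition aut :: "('a \<Rightarrow> 'a) \<Rightarrow> ('a \<Rightarrow> 'a) \<Rightarrow> bool" where
  "aut \<phi> \<psi> \<longleftrightarrow> \<phi> \<in> hom G G \<and> \<psi> \<in> hom G G \<and> (\<forall>g\<in>carrier G. \<psi> (\<phi> g) = g \<and> \<phi> (\<psi> g) = g)"

lemma aut_sym: "aut \<phi> \<psi> \<Longrightarrow> aut \<psi> \<phi>"
  by (auto simp: aut_def)

lemma aut_funpow: "aut \<phi> \<psi> \<Longrightarrow> aut (\<phi> ^^ i) (\<psi> ^^ i)"
proof (induction i)
  case 0
  then show ?case by (auto simp: aut_def hom_def)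
next
  case (Suc i)
  then have h: "\<phi> \<in> hom G G" "\<psi> \<in> hom G G" "\<And>g. g \<in> carrier G \<Longrightarrow> \<psi> (\<phi> g) = g"
    "\<And>g. g \<in> carrier G \<Longrightarrow> \<phi> (\<psi> g) = g" and
    p: "\<And>g. g \<in> carrier G \<Longrightarrow> (\<psi> ^^ i) ((\<phi> ^^ i) g) = g"
    "\<And>g. g \<in> carrier G \<Longrightarrow> (\<phi> ^^ i) ((\<psi> ^^ i) g) = g"
    by (auto simp: aut_def)
  have "(\<psi> ^^ Suc i) ((\<phi> ^^ Suc i) g) = g" if "g \<in> carrier G" for g
  proof -
    have "(\<psi> ^^ Suc i) ((\<phi> ^^ Suc i) g) = (\<psi> ^^ i) (\<psi> (\<phi> ((\<phi> ^^ i) g)))"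
      by (simp add: funpow_swap1)
    then show ?thesis using that p h hom_in_carrier[OF hom_funpow[OF h(1)]] by simp
  qed
  moreover have "(\<phi> ^^ Suc i) ((\<psi> ^^ Suc i) g) = g" if "g \<in> carrier G" for g
  proof -
    have "(\<phi> ^^ Suc i) ((\<psi> ^^ Suc i) g) = (\<phi> ^^ i) (\<phi> (\<psi> ((\<psi> ^^ i) g)))"
      by (simp add: funpow_swap1)
    then show ?thesis using that p h hom_in_carrier[OF hom_funpow[OF h(2)]] by simp
  qed
  ultimately show ?case using h(1,2) hom_funpow unfolding aut_def by blast
qed

lemma hom_of_sum: "hom_of (\<lambda>v. \<Sum>u\<in>U. c u * b u v) g = (\<Sum>u\<in>U. c u * hom_of (b u) g)"
  unfolding hom_of_def pairing_def
  by (simp add: sum_distrib_left sum_distrib_right mult.assoc sum.swap[of _ V U])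

lemma pullback_sum: "pullback \<phi> (\<lambda>v. \<Sum>u\<in>U. c u * b u v) w = (\<Sum>u\<in>U. c u * pullback \<phi> (b u) w)"
  by (simp add: pullback_def hom_of_sum)

lemma hom_of_lin: "hom_of (\<lambda>v. s * \<alpha> v + t * \<beta> v) g = s * hom_of \<alpha> g + t * hom_of \<beta> g"
  by (simp add: hom_of_def pairing_def sum.distrib sum_distrib_left algebra_simps)

lemma pullback_lin: "pullback \<phi> (\<lambda>v. s * \<alpha> v + t * \<beta> v) w = s * pullback \<phi> \<alpha> w + t * pullback \<phi> \<beta> w"
  by (simp add: pullback_def hom_of_lin)

lemma pullback_zero: "(\<And>v. v \<in> V \<Longrightarrow> \<alpha> v = 0) \<Longrightarrow> pullback \<phi> \<alpha> w = 0"
  by (simp add: pullback_def hom_of_def pairing_def)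

lemma pullback_inverse:
  assumes "aut \<phi> \<psi>" "v \<in> V"
  shows "pullback \<psi> (pullback \<phi> \<alpha>) v = \<alpha> v"
  using assms gen_closed[OF assms(2)] by (simp add: pullback_comp aut_def) (simp add: pullback_def hom_of_gen)

section \<open>Twin vertices and supports\<close>

definition nbhd :: "'v \<Rightarrow> 'v set" where
  "nbhd v = {w \<in> V. adj v w}"

text \<open>This is the domination relation: the link of \<open>w\<close> lies in the star of
  \<open>v\<close>. In a regular graph it becomes an equivalence relation.\<close>

definition twins :: "'v \<Rightarrow> 'v set" where
  "twins v = {w \<in> V. nbhd w \<subseteq> insert v (nbhd v)}"

definition supp :: "('v \<Rightarrow> complex) \<Rightarrow> 'v set" where
  "supp \<alpha> = {v \<in> V. \<alpha> v \<noteq> 0}"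

definition pure :: "('v \<Rightarrow> complex) \<Rightarrow> bool" where
  "pure \<alpha> \<longleftrightarrow> supp \<alpha> \<noteq> {} \<and> (\<forall>v\<in>supp \<alpha>. supp \<alpha> \<subseteq> twins v)"

definition maps_support :: "('a \<Rightarrow> 'a) \<Rightarrow> 'v set \<Rightarrow> 'v set \<Rightarrow> bool" where
  "maps_support \<phi> A B \<longleftrightarrow> (\<forall>\<alpha>. supp \<alpha> \<subseteq> A \<longrightarrow> supp (pullback \<phi> \<alpha>) \<subseteq> B)"

lemma finite_nbhd: "finite (nbhd v)"
  using finite_V by (simp add: nbhd_def)

lemma supp_pullback_nonempty:
  assumes "aut \<phi> \<psi>" "supp \<alpha> \<noteq> {}"
  shows "supp (pullback \<phi> \<alpha>) \<noteq> {}"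
proof
  assume "supp (pullback \<phi> \<alpha>) = {}"
  then have "pullback \<phi> \<alpha> v = 0" if "v \<in> V" for v using that by (auto simp: supp_def)
  then have "pullback \<psi> (pullback \<phi> \<alpha>) v = 0" for v by (rule pullback_zero)
  then have "\<alpha> v = 0" if "v \<in> V" for v using pullback_inverse[OF assms(1) that, of \<alpha>] by simp
  then show False using assms(2) by (auto simp: supp_def)
qed

lemma maps_support_comp:
  assumes "\<phi> \<in> hom G G" "\<psi> \<in> hom G G" "maps_support \<phi> A B" "maps_support \<psi> B C"
  shows "maps_support (\<phi> \<circ> \<psi>) A C"
proof -
  have "supp (pullback (\<phi> \<circ> \<psi>) \<alpha>) = supp (pullback \<psi> (pullback \<phi> \<alpha>))" for \<alpha>
    using pullback_comp[OF assms(1,2)] by (auto simp: supp_def)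
  then show ?thesis using assms(3,4) by (simp add: maps_support_def)
qed

end

section \<open>Automorphisms permute the twin classes of a regular graph\<close>

locale regular_raag_group = raag_group +
  fixes k :: nat
  assumes regular: "v \<in> V \<Longrightarrow> card (nbhd v) = k"
begin

text \<open>By regularity and symmetry of adjacency, the two sets have the same size, so inclusion
  forces equality.\<close>

lemma twins_iff:
  assumes "v \<in> V" "w \<in> V"
  shows "w \<in> twins v \<longleftrightarrow> nbhd w - {v} = nbhd v - {w}"
proof
  assume "w \<in> twins v"
  then have sub: "nbhd w - {v} \<subseteq> nbhd v - {w}"
    using adj_irrefl by (auto simp: twins_def nbhd_def)
  have "w \<in> nbhd v \<longleftrightarrow> v \<in> nbhd w" using adj_sym assms by (auto simp: nbhd_def)
  then have "card (nbhd w - {v}) = card (nbhd v - {w})"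
    using regular[OF assms(1)] regular[OF assms(2)] finite_nbhd
    by (simp add: card_Diff_singleton_if)
  with sub show "nbhd w - {v} = nbhd v - {w}"
    using finite_nbhd by (intro card_subset_eq) auto
qed (use assms in \<open>auto simp: twins_def\<close>)

lemma twins_refl: "v \<in> V \<Longrightarrow> v \<in> twins v"
  by (auto simp: twins_def)

lemma twins_subset: "twins v \<subseteq> V"
  by (auto simp: twins_def)

lemma twins_sym: "\<lbrakk>v \<in> V; w \<in> twins v\<rbrakk> \<Longrightarrow> v \<in> twins w"
  using twins_iff[of v w] twins_iff[of w v] twins_subset by blast

text \<open>The equations \<open>1\<close> and \<open>2\<close> settle every neighbour of
  \<open>u\<close> other than \<open>v\<close>. If \<open>v\<close> were a neighbour of
  \<open>u\<close> but not of \<open>w\<close>, then \<open>u\<close> would be a neighbour of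
  \<open>w\<close> by \<open>1\<close>, and hence \<open>w\<close> one of \<open>v\<close> by
  \<open>2\<close>.\<close>

lemma twins_trans:
  assumes "w \<in> V" "v \<in> twins w" "u \<in> twins v"
  shows "u \<in> twins w"
proof (cases "u = w")
  case True
  then show ?thesis using assms twins_refl by simp
next
  case False
  have V: "u \<in> V" "v \<in> V" using assms twins_subset by auto
  have 1: "nbhd v - {w} = nbhd w - {v}" and 2: "nbhd u - {v} = nbhd v - {u}"
    using assms V twins_iff by auto
  have sym: "\<And>x y. x \<in> V \<Longrightarrow> y \<in> V \<Longrightarrow> x \<in> nbhd y \<longleftrightarrow> y \<in> nbhd x"
    using adj_sym by (auto simp: nbhd_def)
  have "nbhd u \<subseteq> insert w (nbhd w)"
  proof
    fix t assume t: "t \<in> nbhd u"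
    show "t \<in> insert w (nbhd w)"
    proof (cases "t = v")
      case False
      then show ?thesis using t 1 2 by blast
    next
      case True
      show ?thesis
      proof (rule ccontr)
        assume n: "t \<notin> insert w (nbhd w)"
        have "u \<in> nbhd v" using t True V sym by blast
        then have "u \<in> nbhd w" using 1 False by blast
        then have "w \<in> nbhd u" using sym V assms(1) by blast
        then have "w \<in> nbhd v" using 2 n True by blast
        then show False using sym V assms(1) n True by blast
      qed
    qed
  qed
  then show ?thesis using V by (simp add: twins_def)
qed

lemma twins_eq: "\<lbrakk>v \<in> V; w \<in> twins v\<rbrakk> \<Longrightarrow> twins w = twins v"
  using twins_trans[of v w] twins_trans[of w v] twins_sym[of v w] twins_subset by blast

lemma twins_disjoint: "\<lbrakk>a \<in> V; b \<in> V; v \<in> twins a; v \<in> twins b\<rbrakk> \<Longrightarrow> twins a = twins b"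
  using twins_eq by metis

lemma pureI:
  assumes "supp \<alpha> \<noteq> {}" "a \<in> V" "supp \<alpha> \<subseteq> twins a"
  shows "pure \<alpha>"
  using assms twins_eq[OF assms(2)] unfolding pure_def by blast

text \<open>
  The space of all \<open>\<beta>\<close> perpendicular to a nonzero \<open>\<alpha>\<close> has dimension at most
  \<open>card V - k\<close>, and the pure \<open>\<alpha>\<close> are those that attain this bound. So automorphisms preserve purity.
\<close>

lemma perp_determined:
  assumes "supp \<alpha> \<noteq> {}" "\<not> pure \<alpha>"
  shows "\<exists>T\<subseteq>V. card T < card V - k \<and> (\<forall>\<beta>. perp \<alpha> \<beta> \<longrightarrow> (\<forall>t\<in>T. \<beta> t = 0) \<longrightarrow> (\<forall>v\<in>V. \<beta> v = 0))"
proof -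
  obtain v w where vw: "v \<in> V" "\<alpha> v \<noteq> 0" "w \<in> V" "\<alpha> w \<noteq> 0" "w \<notin> twins v"
    using assms by (auto simp: pure_def supp_def)
  then obtain u where u: "u \<in> nbhd w" "u \<noteq> v" "u \<notin> nbhd v" by (auto simp: twins_def)
  \<comment> \<open>If \<open>\<beta>\<close> vanishes on \<open>T\<close>, it vanishes at
    \<open>v\<close>, hence on \<open>nbhd v\<close> because \<open>\<alpha> v \<noteq> 0\<close>,
    hence at \<open>w\<close>. The edge between \<open>w\<close> and \<open>u\<close> with
    \<open>\<alpha> w \<noteq> 0\<close> then gives \<open>\<beta> u = 0\<close>, so
    \<open>u\<close> can be left out of \<open>T\<close>.\<close>
  define T where "T = V - nbhd v - {u}"
  have uV: "u \<in> V" "adj w u" "adj u w" using u adj_sym by (auto simp: nbhd_def)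
  have nbV: "nbhd v \<subseteq> V" by (auto simp: nbhd_def)
  have "card (V - nbhd v) = card V - k"
    using regular[OF vw(1)] nbV finite_nbhd by (simp add: card_Diff_subset)
  moreover have "u \<in> V - nbhd v" using uV u by simp
  ultimately have "card T < card V - k"
    using finite_V unfolding T_def by (metis card_Diff1_less finite_Diff)
  moreover have "\<beta> x = 0" if p: "perp \<alpha> \<beta>" and T: "\<forall>t\<in>T. \<beta> t = 0" and x: "x \<in> V" for \<beta> x
  proof -
    have "v \<in> T" using vw(1) u(2) adj_irrefl by (auto simp: T_def nbhd_def)
    then have v0: "\<beta> v = 0" using T by simp
    have nb0: "\<beta> t = 0" if "t \<in> nbhd v" for t
    proof -
      have "\<alpha> v * \<beta> t = \<alpha> t * \<beta> v" using p that vw(1) by (auto simp: perp_def nbhd_def)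
      then show ?thesis using v0 vw(2) by simp
    qed
    have w0: "\<beta> w = 0"
      using nb0[of w] T vw(3) uV adj_irrefl by (cases "w \<in> nbhd v") (auto simp: T_def)
    have "\<alpha> w * \<beta> u = \<alpha> u * \<beta> w" using p vw(3) uV by (auto simp: perp_def)
    then have "\<beta> u = 0" using w0 vw(4) by simp
    then show ?thesis using nb0 T x by (auto simp: T_def)
  qed
  ultimately show ?thesis by (intro exI[of _ T]) (auto simp: T_def)
qed

text \<open>A pure \<open>\<alpha>\<close> has \<open>card V - k\<close> independent perpendicular
  functionals. If the pullback were not pure, fewer coordinates would detect everything
  perpendicular to it. Then the pullback of some nontrivial combination would vanish at these
  coordinates, hence everywhere, against injectivity.\<close>

lemma pure_pullback:
  assumes aut: "aut \<phi> \<psi>" and "pure \<alpha>"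
  shows "pure (pullback \<phi> \<alpha>)"
proof (rule ccontr)
  assume "\<not> pure (pullback \<phi> \<alpha>)"
  moreover have "supp (pullback \<phi> \<alpha>) \<noteq> {}"
    using assms by (intro supp_pullback_nonempty) (auto simp: pure_def)
  ultimately obtain T where T: "T \<subseteq> V" "card T < card V - k"
    "\<And>\<beta>. \<lbrakk>perp (pullback \<phi> \<alpha>) \<beta>; \<forall>t\<in>T. \<beta> t = 0\<rbrakk> \<Longrightarrow> \<forall>v\<in>V. \<beta> v = 0"
    using perp_determined[of "pullback \<phi> \<alpha>"] by blast
  obtain v where v: "v \<in> V" "\<alpha> v \<noteq> 0" "supp \<alpha> \<subseteq> twins v"
    using assms(2) by (auto simp: pure_def supp_def)
  define U where "U = V - nbhd v"
  \<comment> \<open>These are \<open>\<alpha>\<close> itself and the coordinate functionals at the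
    other non-neighbours \<open>u\<close> of \<open>v\<close>. The latter are perpendicular to
    \<open>\<alpha>\<close>: a vertex in the support of \<open>\<alpha>\<close> is a twin of
    \<open>v\<close>, so its neighbours lie in the star of \<open>v\<close>, which misses
    \<open>u\<close>.\<close>
  define b where "b u = (if u = v then \<alpha> else (\<lambda>x. if x = u then 1 else 0))" for u
  have "nbhd v \<subseteq> V" by (auto simp: nbhd_def)
  then have cardU: "card U = card V - k"
    using regular[OF v(1)] finite_nbhd by (simp add: U_def card_Diff_subset)
  have vU: "v \<in> U" using v(1) adj_irrefl by (auto simp: U_def nbhd_def)
  have finU: "finite U" using finite_V by (simp add: U_def)
  have perp_b: "perp \<alpha> (b u)" if u: "u \<in> U" for u
  proof (cases "u = v")
    case True
    then show ?thesis by (simp add: b_def perp_def)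
  next
    case False
    have *: "\<alpha> x = 0" if x: "x \<in> V" "adj x u" for x
    proof (rule ccontr)
      assume "\<alpha> x \<noteq> 0"
      then have "nbhd x \<subseteq> insert v (nbhd v)" using v(3) x(1) by (auto simp: supp_def twins_def)
      moreover have "u \<in> nbhd x" using x u by (simp add: nbhd_def U_def)
      ultimately show False using u False by (auto simp: U_def)
    qed
    then show ?thesis using False adj_sym by (auto simp: b_def perp_def)
  qed
  obtain c where c: "\<exists>u\<in>U. c u \<noteq> 0" "\<forall>t\<in>T. (\<Sum>u\<in>U. c u * pullback \<phi> (b u) t) = 0"
    using underdetermined_system[of T U "\<lambda>u. pullback \<phi> (b u)"] T(1,2) cardU finU finite_V finite_subset
    by metis
  define \<beta> where "\<beta> = (\<lambda>x. \<Sum>u\<in>U. c u * b u x)"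
  have "perp \<alpha> \<beta>"
    unfolding perp_def
  proof (intro ballI impI)
    fix x y assume xy: "x \<in> V" "y \<in> V" "adj x y"
    have "\<alpha> x * b u y = \<alpha> y * b u x" if "u \<in> U" for u
      using perp_b[OF that] xy unfolding perp_def by blast
    then have "(\<Sum>u\<in>U. c u * (\<alpha> x * b u y)) = (\<Sum>u\<in>U. c u * (\<alpha> y * b u x))" by simp
    then show "\<alpha> x * \<beta> y = \<alpha> y * \<beta> x"
      by (simp add: \<beta>_def sum_distrib_left mult.left_commute)
  qed
  then have "perp (pullback \<phi> \<alpha>) (pullback \<phi> \<beta>)" using aut perp_pullback by (simp add: aut_def)
  moreover have "\<forall>t\<in>T. pullback \<phi> \<beta> t = 0" using c(2) by (simp add: \<beta>_def pullback_sum)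
  ultimately have "\<forall>x\<in>V. pullback \<phi> \<beta> x = 0" by (rule T(3))
  then have \<beta>0: "\<beta> x = 0" if "x \<in> V" for x
    using pullback_zero[of "pullback \<phi> \<beta>" \<psi> x] pullback_inverse[OF aut that, of \<beta>] by simp
  have *: "(\<Sum>u\<in>U. c u * b u x) = c v * \<alpha> x + (\<Sum>u\<in>U-{v}. if u = x then c u else 0)" for x
    by (subst sum.remove[OF finU vU]) (auto simp: b_def intro!: sum.cong split: if_splits)
  have "c v * \<alpha> v = 0" using \<beta>0[OF v(1)] unfolding \<beta>_def * using finU by simp
  then have cv: "c v = 0" using v(2) by simp
  have "c x = 0" if "x \<in> U" for x
  proof (cases "x = v")
    case False
    have "x \<in> V" using that by (simp add: U_def)
    from \<beta>0[OF this] show ?thesis unfolding \<beta>_def * cv using finU that False by simp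
  qed (use cv in simp)
  then show False using c(1) by blast
qed

text \<open>The pullback of the coordinate functional \<open>d\<close> at \<open>a\<close> is pure
  and selects the class of \<open>b\<close>. If the pullback of some \<open>\<alpha>\<close> on
  \<open>twins a\<close> were nonzero at \<open>u\<close> outside this class, a multiple of
  \<open>d\<close> could be added to make it nonzero at both \<open>u\<close> and \<open>b\<close>,
  contradicting \<open>pure_pullback\<close>.\<close>

lemma maps_support_twins:
  assumes aut: "aut \<phi> \<psi>" and a: "a \<in> V"
  shows "\<exists>b\<in>V. maps_support \<phi> (twins a) (twins b)"
proof -
  define d where "d = (\<lambda>v. if v = a then 1 else (0::complex))"
  have "supp d = {a}" using a by (auto simp: d_def supp_def)
  then have "pure d" using a twins_refl by (intro pureI[of _ a]) auto
  then have pd: "pure (pullback \<phi> d)" by (rule pure_pullback[OF aut])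
  then obtain b where b: "b \<in> V" "pullback \<phi> d b \<noteq> 0" "supp (pullback \<phi> d) \<subseteq> twins b"
    by (auto simp: pure_def supp_def)
  have "u \<in> twins b" if \<alpha>: "supp \<alpha> \<subseteq> twins a" and u: "u \<in> supp (pullback \<phi> \<alpha>)" for \<alpha> u
  proof (rule ccontr)
    assume nu: "u \<notin> twins b"
    have u0: "pullback \<phi> d u = 0" using nu u b(3) by (auto simp: supp_def)
    obtain s where s: "pullback \<phi> \<alpha> b + s * pullback \<phi> d b \<noteq> 0"
    proof (cases "pullback \<phi> \<alpha> b = 0")
      case True
      then show thesis using that[of 1] b(2) by simp
    next
      case False
      then show thesis using that[of 0] by simp
    qed
    define \<gamma> where "\<gamma> = (\<lambda>v. 1 * \<alpha> v + s * d v)"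
    have pullback: "pullback \<phi> \<gamma> w = pullback \<phi> \<alpha> w + s * pullback \<phi> d w" for w
      unfolding \<gamma>_def pullback_lin by simp
    have ub: "u \<in> supp (pullback \<phi> \<gamma>)" "b \<in> supp (pullback \<phi> \<gamma>)"
      using u u0 s b(1) by (auto simp: supp_def pullback)
    then have "supp \<gamma> \<noteq> {}" using pullback_zero[of \<gamma> \<phi> u] by (auto simp: supp_def)
    moreover have "supp \<gamma> \<subseteq> twins a" using \<alpha> a twins_refl by (auto simp: supp_def \<gamma>_def d_def)
    ultimately have "pure \<gamma>" using a by (intro pureI[of _ a])
    then have "pure (pullback \<phi> \<gamma>)" by (rule pure_pullback[OF aut])
    then show False using ub nu by (auto simp: pure_def)
  qed
  then show ?thesis using b(1) unfolding maps_support_def by blast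
qed

text \<open>The sum of the coordinate functionals at \<open>a\<close> and \<open>b\<close> has its
  pullback in one class, so this pullback is pure. Pulling back along the inverse shows that the sum
  itself is pure.\<close>

lemma maps_support_twins_inj:
  assumes aut: "aut \<phi> \<psi>" and V: "a \<in> V" "b \<in> V" "c \<in> V"
    and maps_support: "maps_support \<phi> (twins a) (twins c)" "maps_support \<phi> (twins b) (twins c)"
  shows "twins a = twins b"
proof -
  define d :: "'c \<Rightarrow> 'c \<Rightarrow> complex" where "d x = (\<lambda>v. if v = x then 1 else (0::complex))" for x
  have sd: "supp (d x) = {x}" if "x \<in> V" for x using that by (auto simp: d_def supp_def)
  define \<gamma> where "\<gamma> = (\<lambda>v. 1 * d a v + 1 * d b v)"
  have ab: "a \<in> supp \<gamma>" "b \<in> supp \<gamma>" using V by (auto simp: supp_def \<gamma>_def d_def)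
  have pullback: "pullback \<phi> \<gamma> w = pullback \<phi> (d a) w + pullback \<phi> (d b) w" for w
    unfolding \<gamma>_def pullback_lin by simp
  have "supp (pullback \<phi> (d a)) \<subseteq> twins c" "supp (pullback \<phi> (d b)) \<subseteq> twins c"
    using maps_support sd V twins_refl by (auto simp: maps_support_def)
  moreover have "supp (pullback \<phi> \<gamma>) \<subseteq> supp (pullback \<phi> (d a)) \<union> supp (pullback \<phi> (d b))"
    by (auto simp: supp_def pullback)
  ultimately have "supp (pullback \<phi> \<gamma>) \<subseteq> twins c" by blast
  moreover have "supp (pullback \<phi> \<gamma>) \<noteq> {}" using ab by (intro supp_pullback_nonempty[OF aut]) auto
  ultimately have "pure (pullback \<phi> \<gamma>)" using V by (intro pureI[of _ c])
  then have "pure (pullback \<psi> (pullback \<phi> \<gamma>))" by (rule pure_pullback[OF aut_sym[OF aut]])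
  moreover have "supp (pullback \<psi> (pullback \<phi> \<gamma>)) = supp \<gamma>"
    using pullback_inverse[OF aut] by (auto simp: supp_def)
  ultimately have "b \<in> twins a" using ab by (auto simp: pure_def)
  then show ?thesis using V twins_eq by blast
qed

lemma maps_support_twins_unique:
  assumes aut: "aut \<phi> \<psi>" and V: "a \<in> V" "b \<in> V" "c \<in> V"
    and maps_support: "maps_support \<phi> (twins a) (twins b)" "maps_support \<phi> (twins a) (twins c)"
  shows "twins b = twins c"
proof -
  define d where "d = (\<lambda>v. if v = a then 1 else (0::complex))"
  have sd: "supp d = {a}" using V by (auto simp: d_def supp_def)
  then have "supp (pullback \<phi> d) \<noteq> {}" by (intro supp_pullback_nonempty[OF aut]) auto
  moreover have "supp (pullback \<phi> d) \<subseteq> twins b \<inter> twins c" using maps_support sd V twins_refl by (auto simp: maps_support_def)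
  ultimately show ?thesis using V twins_disjoint by blast
qed

text \<open>The pigeonhole principle for the images of the pair of classes gives
  \<open>i < j\<close> with equal images under \<open>\<phi> ^^ i\<close> and
  \<open>\<phi> ^^ j\<close>. Injectivity on classes then cancels
  \<open>\<phi> ^^ i\<close>.\<close>

lemma maps_support_twins_period:
  assumes aut: "aut \<phi> \<psi>" and V: "a \<in> V" "b \<in> V"
  shows "\<exists>m>0. maps_support (\<phi> ^^ m) (twins a) (twins a) \<and> maps_support (\<phi> ^^ m) (twins b) (twins b)"
proof -
  note autp = aut_funpow[OF aut]
  have hom: "(\<phi> ^^ i) \<in> hom G G" for i using autp by (simp add: aut_def)
  have "\<forall>i. \<forall>x\<in>V. \<exists>y\<in>V. maps_support (\<phi> ^^ i) (twins x) (twins y)" using maps_support_twins[OF autp] by blast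
  then obtain t where t: "\<And>i x. x \<in> V \<Longrightarrow> t i x \<in> V"
    "\<And>i x. x \<in> V \<Longrightarrow> maps_support (\<phi> ^^ i) (twins x) (twins (t i x))" by metis
  define f where "f i = (twins (t i a), twins (t i b))" for i
  have "range f \<subseteq> twins ` V \<times> twins ` V" using t(1) V by (auto simp: f_def)
  then have "finite (range f)" using finite_V by (meson finite_SigmaI finite_imageI finite_subset)
  then have "\<not> inj f" using finite_imageD infinite_UNIV_nat by blast
  then obtain i j where ij: "f i = f j" "i < j" unfolding inj_def by (metis linorder_neqE_nat)
  have periodic: "maps_support (\<phi> ^^ (j - i)) (twins x) (twins x)" if x: "x \<in> V" and eq: "twins (t i x) = twins (t j x)" for x
  proof -
    let ?y = "t (j - i) x"
    have y: "?y \<in> V" using x t(1) by simp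
    have "maps_support (\<phi> ^^ (j - i) \<circ> \<phi> ^^ i) (twins x) (twins (t i ?y))"
      using t(2)[OF x] t(2)[OF y] by (intro maps_support_comp hom)
    then have "maps_support (\<phi> ^^ j) (twins x) (twins (t i ?y))" using ij(2) by (simp add: funpow_add[symmetric])
    then have "twins (t i ?y) = twins (t i x)"
      using maps_support_twins_unique[OF autp x t(1)[OF y] t(1)[OF x]] t(2)[OF x] eq by metis
    then have "twins ?y = twins x"
      using maps_support_twins_inj[OF autp y x t(1)[OF x]] t(2)[OF y] t(2)[OF x] by metis
    then show ?thesis using t(2)[OF x] by metis
  qed
  show ?thesis
    using ij periodic[OF V(1)] periodic[OF V(2)] by (intro exI[of _ "j - i"]) (auto simp: f_def)
qed

end

section \<open>Invariant homomorphisms and Reidemeister numbers\<close>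

text \<open>The factor starts with \<open>aX\<close>, so it shifts a series that vanishes below
  index \<open>m\<close> by one place and multiplies its leading coefficient by
  \<open>a\<close>.\<close>

lemma fps_exp_minus_1_mult:
  fixes f :: "complex fps"
  assumes "\<And>i. i < m \<Longrightarrow> fps_nth f i = 0"
  shows "fps_nth ((fps_exp a - 1) * f) (Suc m) = a * fps_nth f m"
    and "i \<le> m \<Longrightarrow> fps_nth ((fps_exp a - 1) * f) i = 0"
proof -
  have "fps_nth ((fps_exp a - 1) * f) (Suc m)
      = (\<Sum>i\<in>{1}. fps_nth (fps_exp a - 1) i * fps_nth f (Suc m - i))"
    unfolding fps_mult_nth
  proof (rule sum.mono_neutral_right)
    show "\<forall>i\<in>{0..Suc m} - {1}. fps_nth (fps_exp a - 1) i * fps_nth f (Suc m - i) = 0"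
    proof
      fix i assume i: "i \<in> {0..Suc m} - {1}"
      show "fps_nth (fps_exp a - 1) i * fps_nth f (Suc m - i) = 0"
      proof (cases "i = 0")
        case False
        then have "Suc m - i < m" using i by auto
        then show ?thesis using assms by simp
      qed simp
    qed
  qed auto
  then show "fps_nth ((fps_exp a - 1) * f) (Suc m) = a * fps_nth f m" by simp
  assume "i \<le> m"
  have "fps_nth (fps_exp a - 1) j * fps_nth f (i - j) = 0" if "j \<in> {0..i}" for j
  proof (cases "j = 0")
    case False
    then have "i - j < m" using that \<open>i \<le> m\<close> by auto
    then show ?thesis using assms by simp
  qed simp
  then show "fps_nth ((fps_exp a - 1) * f) i = 0" unfolding fps_mult_nth by (intro sum.neutral) blast
qed

text \<open>\<open>N_twisted\<close> confines the conjugators between elements of \<open>N\<close>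
  to \<open>N\<close>, where \<open>F\<close> is additive and invariant under \<open>\<phi>\<close>.
  So \<open>F\<close> agrees on twisted conjugate elements of \<open>N\<close>, while it takes
  infinitely many values on the powers of \<open>x\<^sub>0\<close>.\<close>

lemma (in group) infinite_reidemeister:
  assumes \<phi>: "\<phi> \<in> hom G G" and N: "subgroup N G" "\<phi> ` N \<subseteq> N"
    and F: "\<And>x y. \<lbrakk>x \<in> N; y \<in> N\<rbrakk> \<Longrightarrow> F (x \<otimes> y) = F x + (F y :: complex)"
    and F_fixed: "\<And>x. x \<in> N \<Longrightarrow> F (\<phi> x) = F x"
    and nz: "x\<^sub>0 \<in> N" "F x\<^sub>0 \<noteq> 0"
    and N_twisted: "\<And>g x y. \<lbrakk>g \<in> carrier G; x \<in> N; y \<in> N; x = g \<otimes> y \<otimes> inv (\<phi> g)\<rbrakk> \<Longrightarrow> g \<in> N"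
  shows "reidemeister_number G \<phi> = \<infinity>"
proof -
  interpret N: subgroup N G by fact
  let ?R = "twisted_conj_rel G \<phi>"
  have one: "F \<one> = 0" using F[of \<one> \<one>] by simp
  have inv: "F (inv x) = - F x" if "x \<in> N" for x
    using F[of x "inv x"] that one by (simp add: eq_neg_iff_add_eq_0 add.commute)
  have inj: "F x = F y" if xy: "x \<in> N" "y \<in> N" "(x, y) \<in> ?R" for x y
  proof -
    obtain g where g: "g \<in> carrier G" "x = g \<otimes> y \<otimes> inv (\<phi> g)"
      using xy(3) by (auto simp: twisted_conj_rel_def)
    have gN: "g \<in> N" using N_twisted[OF g(1) xy(1,2) g(2)] .
    then have "\<phi> g \<in> N" using N(2) by auto
    then show ?thesis using gN xy(2) F inv F_fixed unfolding g(2) by simp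
  qed
  define P where "P n = x\<^sub>0 [^] (n::nat)" for n
  have PN: "P n \<in> N" for n unfolding P_def using nz(1) by (induction n) auto
  have FP: "F (P n) = of_nat n * F x\<^sub>0" for n
    unfolding P_def
  proof (induction n)
    case (Suc n)
    then show ?case using PN[of n] F nz(1) by (simp add: P_def algebra_simps)
  qed (simp add: one)
  have refl: "(x, x) \<in> ?R" if "x \<in> N" for x
    using that hom_one[OF \<phi> is_group is_group] by (auto simp: twisted_conj_rel_def intro!: bexI[of _ \<one>])
  have "inj (\<lambda>n. ?R `` {P n})"
  proof (rule injI)
    fix m n assume "?R `` {P m} = ?R `` {P n}"
    then have "(P m, P n) \<in> ?R" using refl[OF PN[of n]] by auto
    then have "F (P m) = F (P n)" using inj PN by blast
    then show "m = n" using nz(2) by (simp add: FP)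
  qed
  moreover have "range (\<lambda>n. ?R `` {P n}) \<subseteq> carrier G // ?R"
    using PN by (auto intro: quotientI)
  ultimately have "infinite (carrier G // ?R)"
    by (meson finite_subset finite_imageD infinite_UNIV_nat)
  then show ?thesis by (simp add: reidemeister_number_def)
qed

section \<open>Commutators and the kernel of the abelianization\<close>

context raag_group
begin

definition commutator :: "'a \<Rightarrow> 'a \<Rightarrow> 'a" where
  "commutator g h = (g \<otimes> h) \<otimes> inv (h \<otimes> g)"

definition ab_ker :: "'a set" where
  "ab_ker = {g \<in> carrier G. \<forall>v\<in>V. ex v g = 0}"

lemma subgroup_ab_ker: "subgroup ab_ker G"
  by unfold_locales (auto simp: ab_ker_def ex_mult ex_one ex_inv)

lemma hom_of_ab_ker: "g \<in> ab_ker \<Longrightarrow> hom_of \<alpha> g = 0"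
  by (simp add: ab_ker_def hom_of_def pairing_def)

lemma hom_of_delta: "v \<in> V \<Longrightarrow> hom_of (\<lambda>u. if u = v then 1 else 0) g = of_int (ex v g)"
  using finite_V by (simp add: hom_of_def pairing_def if_distrib[of "\<lambda>t. t * _"] cong: if_cong)

lemma ab_ker_hom:
  assumes "\<phi> \<in> hom G G" "g \<in> ab_ker"
  shows "\<phi> g \<in> ab_ker"
proof -
  have "g \<in> carrier G" using assms by (simp add: ab_ker_def)
  then have "of_int (ex v (\<phi> g)) = (0::complex)" if "v \<in> V" for v
    using hom_of_pullback[OF assms(1)] hom_of_ab_ker[OF assms(2)] hom_of_delta[OF that, of "\<phi> g"] by metis
  then show ?thesis using assms hom_in_carrier[OF assms(1)] \<open>g \<in> carrier G\<close> by (simp add: ab_ker_def)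
qed

lemma commutator_ab_ker: "\<lbrakk>g \<in> carrier G; h \<in> carrier G\<rbrakk> \<Longrightarrow> commutator g h \<in> ab_ker"
  by (simp add: commutator_def ab_ker_def ex_mult ex_inv)

text \<open>\<open>g \<otimes> h\<close> and \<open>h \<otimes> g\<close> have the same value under
  \<open>hom_of \<alpha>\<close>, so the exponential factors cancel and the value of
  \<open>c\<close> on their quotient is the difference of its values on the two products.\<close>

lemma cocycle_commutator:
  assumes "cocycle \<alpha> c" "g \<in> carrier G" "h \<in> carrier G"
  shows "c (commutator g h) = (fps_exp (hom_of \<alpha> g) - 1) * c h - (fps_exp (hom_of \<alpha> h) - 1) * c g"
proof -
  have mult: "c (x \<otimes> y) = c x + fps_exp (hom_of \<alpha> x) * c y" if "x \<in> carrier G" "y \<in> carrier G" for x y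
    using assms(1) that by (simp add: cocycle_def)
  define u w where "u = g \<otimes> h" and "w = h \<otimes> g"
  have uw: "u \<in> carrier G" "w \<in> carrier G" "hom_of \<alpha> u = hom_of \<alpha> w"
    using assms by (simp_all add: u_def w_def hom_of_mult)
  have "c (inv w \<otimes> w) = c (inv w) + fps_exp (- hom_of \<alpha> w) * c w"
    using uw by (subst mult) (simp_all add: hom_of_inv)
  then have inv: "c (inv w) = - fps_exp (- hom_of \<alpha> w) * c w"
    using uw cocycle_one[OF assms(1)] by (simp add: eq_neg_iff_add_eq_0)
  have "c (u \<otimes> inv w) = c u - (fps_exp (hom_of \<alpha> u) * fps_exp (- hom_of \<alpha> w)) * c w"
    using uw by (subst mult) (simp_all add: inv algebra_simps)
  also have "\<dots> = c u - c w" using uw(3) by (simp add: fps_exp_add_mult[symmetric])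
  finally show ?thesis using assms(2,3) unfolding commutator_def u_def w_def by (simp add: mult algebra_simps)
qed

primrec nested :: "nat \<Rightarrow> 'a set" where
  "nested 0 = (\<Union>v\<in>V. \<Union>w\<in>V. {commutator (gen v) (gen w)})"
| "nested (Suc n) = (\<Union>v\<in>V. \<Union>z\<in>nested n. {commutator (gen v) z})"

text \<open>The multilinear extension, from generators to vectors, of the value of \<open>p\<close>
  on an iterated commutator. The head of the list is the outermost entry, and the recursion absorbs
  it into \<open>p\<close>.\<close>

primrec bracket_eval :: "('v \<Rightarrow> complex) list \<Rightarrow> ('v \<Rightarrow> complex) \<Rightarrow> ('v \<Rightarrow> complex) \<Rightarrow> ('a \<Rightarrow> complex) \<Rightarrow> complex" where
  "bracket_eval [] x y p = (\<Sum>v\<in>V. \<Sum>w\<in>V. x v * y w * p (commutator (gen v) (gen w)))"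
| "bracket_eval (z # xs) x y p = bracket_eval xs x y (\<lambda>g. \<Sum>u\<in>V. z u * p (commutator (gen u) g))"

definition bracket_form :: "('v \<Rightarrow> complex) \<Rightarrow> ('v \<Rightarrow> complex) \<Rightarrow> ('v \<Rightarrow> complex) list \<Rightarrow> ('v \<Rightarrow> complex) \<Rightarrow> ('v \<Rightarrow> complex) \<Rightarrow> complex" where
  "bracket_form \<alpha> \<beta> xs x y = prod_list (map (pairing V \<alpha>) xs) * (pairing V \<alpha> x * pairing V \<beta> y - pairing V \<alpha> y * pairing V \<beta> x)"

lemma nested_ab_ker: "g \<in> nested n \<Longrightarrow> g \<in> ab_ker"
proof (induction n arbitrary: g)
  case (Suc n)
  then obtain v z where vz: "v \<in> V" "z \<in> nested n" "g = commutator (gen v) z" by auto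
  then have "z \<in> carrier G" using Suc.IH by (simp add: ab_ker_def)
  then show ?case unfolding vz(3) using vz(1) gen_closed commutator_ab_ker by blast
qed (use gen_closed commutator_ab_ker in auto)

lemma bracket_eval_cong: "(\<And>g. g \<in> nested (length xs) \<Longrightarrow> p g = q g) \<Longrightarrow> bracket_eval xs x y p = bracket_eval xs x y q"
proof (induction xs arbitrary: p q)
  case Nil
  then have "p (commutator (gen v) (gen w)) = q (commutator (gen v) (gen w))" if "v \<in> V" "w \<in> V" for v w
    using that by auto
  then show ?case by simp
next
  case (Cons z xs)
  have "bracket_eval xs x y (\<lambda>g. \<Sum>u\<in>V. z u * p (commutator (gen u) g)) = bracket_eval xs x y (\<lambda>g. \<Sum>u\<in>V. z u * q (commutator (gen u) g))"
    by (intro Cons.IH sum.cong HOL.refl) (use Cons.prems in auto)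
  then show ?case by simp
qed

lemma bracket_eval_sum: "bracket_eval xs x y (\<lambda>g. \<Sum>i\<in>I. c i * p i g) = (\<Sum>i\<in>I. c i * bracket_eval xs x y (p i))"
proof (induction xs arbitrary: p)
  case Nil
  have "bracket_eval [] x y (\<lambda>g. \<Sum>i\<in>I. c i * p i g)
      = (\<Sum>v\<in>V. \<Sum>w\<in>V. \<Sum>i\<in>I. c i * (x v * y w * p i (commutator (gen v) (gen w))))"
    by (simp add: sum_distrib_left algebra_simps)
  also have "\<dots> = (\<Sum>v\<in>V. \<Sum>i\<in>I. \<Sum>w\<in>V. c i * (x v * y w * p i (commutator (gen v) (gen w))))"
    by (intro sum.cong HOL.refl sum.swap)
  also have "\<dots> = (\<Sum>i\<in>I. \<Sum>v\<in>V. \<Sum>w\<in>V. c i * (x v * y w * p i (commutator (gen v) (gen w))))"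
    by (rule sum.swap)
  finally show ?case by (simp add: sum_distrib_left)
next
  case (Cons z xs)
  have "(\<Sum>u\<in>V. z u * (\<Sum>i\<in>I. c i * p i (commutator (gen u) g)))
      = (\<Sum>i\<in>I. c i * (\<Sum>u\<in>V. z u * p i (commutator (gen u) g)))" for g
    unfolding sum_distrib_left by (subst sum.swap) (simp add: mult.left_commute)
  then show ?case by (simp add: Cons.IH)
qed

lemma bracket_eval_cmult: "bracket_eval xs x y (\<lambda>g. c * p g) = c * bracket_eval xs x y p"
  using bracket_eval_sum[of xs x y "\<lambda>_. c" "\<lambda>_. p" "{()}"] by simp

text \<open>\<open>hom_of \<alpha>\<close> vanishes on the inner commutator, so each further
  commutator with a generator just multiplies \<open>c\<close> by a series without constant
  term.\<close>

lemma cocycle_nested: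
  assumes "cocycle \<alpha> c"
  shows "g \<in> nested n \<Longrightarrow> i \<le> n \<Longrightarrow> fps_nth (c g) i = 0"
proof (induction n arbitrary: g i)
  case 0
  then obtain v w where vw: "v \<in> V" "w \<in> V" "g = commutator (gen v) (gen w)" by auto
  show ?case unfolding vw(3) using 0 gen_closed[OF vw(1)] gen_closed[OF vw(2)]
    by (subst cocycle_commutator[OF assms]) auto
next
  case (Suc n)
  then obtain v z where vz: "v \<in> V" "z \<in> nested n" "g = commutator (gen v) z" by auto
  have z: "z \<in> carrier G" "hom_of \<alpha> z = 0" using nested_ab_ker[OF vz(2)] hom_of_ab_ker by (auto simp: ab_ker_def)
  have "c g = (fps_exp (hom_of \<alpha> (gen v)) - 1) * c z"
    unfolding vz(3) using z gen_closed[OF vz(1)] by (subst cocycle_commutator[OF assms]) auto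
  moreover have "fps_nth (c z) i = 0" if "i < Suc n" for i using Suc.IH[OF vz(2)] that by simp
  ultimately show ?case using fps_exp_minus_1_mult(2)[of "Suc n" "c z" i] Suc.prems by simp
qed

text \<open>By \<open>cocycle_nested\<close>, this is the first index at which \<open>c\<close> may
  be nonzero on these commutators. Each outer entry \<open>z\<close> shifts the index by one and
  contributes \<open>pairing V \<alpha> z\<close>; the innermost commutator contributes the
  determinant.\<close>

lemma bracket_eval_cocycle:
  assumes "cocycle \<alpha> c"
  shows "bracket_eval xs x y (\<lambda>g. fps_nth (c g) (Suc (length xs))) = bracket_form \<alpha> (\<lambda>v. fps_nth (c (gen v)) 0) xs x y"
proof (induction xs)
  case Nil
  have "fps_nth (c (commutator (gen v) (gen w))) 1
      = \<alpha> v * fps_nth (c (gen w)) 0 - \<alpha> w * fps_nth (c (gen v)) 0" if "v \<in> V" "w \<in> V" for v w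
    using that gen_closed fps_exp_minus_1_mult(1)[of 0]
    by (simp add: cocycle_commutator[OF assms] hom_of_gen)
  then have "bracket_eval [] x y (\<lambda>g. fps_nth (c g) (Suc 0)) = (\<Sum>v\<in>V. \<Sum>w\<in>V. x v * y w *
      (\<alpha> v * fps_nth (c (gen w)) 0 - \<alpha> w * fps_nth (c (gen v)) 0))"
    by simp
  also have "\<dots> = (\<Sum>v\<in>V. \<Sum>w\<in>V. (\<alpha> v * x v) * (fps_nth (c (gen w)) 0 * y w))
      - (\<Sum>v\<in>V. \<Sum>w\<in>V. (fps_nth (c (gen v)) 0 * x v) * (\<alpha> w * y w))"
    by (simp add: sum_subtractf[symmetric] algebra_simps)
  also have "\<dots> = pairing V \<alpha> x * pairing V (\<lambda>v. fps_nth (c (gen v)) 0) y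
      - pairing V (\<lambda>v. fps_nth (c (gen v)) 0) x * pairing V \<alpha> y"
    unfolding pairing_def sum_product ..
  also have "\<dots> = bracket_form \<alpha> (\<lambda>v. fps_nth (c (gen v)) 0) [] x y"
    by (simp add: bracket_form_def mult.commute)
  finally show ?case by simp
next
  case (Cons z xs)
  let ?n = "length xs"
  have "(\<Sum>u\<in>V. z u * fps_nth (c (commutator (gen u) g)) (Suc (Suc ?n))) = pairing V \<alpha> z * fps_nth (c g) (Suc ?n)"
    if g: "g \<in> nested ?n" for g
  proof -
    have gc: "g \<in> carrier G" "hom_of \<alpha> g = 0" using nested_ab_ker[OF g] hom_of_ab_ker by (auto simp: ab_ker_def)
    have "fps_nth (c g) i = 0" if "i < Suc ?n" for i using cocycle_nested[OF assms g] that by simp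
    from fps_exp_minus_1_mult(1)[OF this]
    have "fps_nth (c (commutator (gen u) g)) (Suc (Suc ?n)) = \<alpha> u * fps_nth (c g) (Suc ?n)" if "u \<in> V" for u
      using that gc gen_closed by (simp add: cocycle_commutator[OF assms] hom_of_gen)
    then show ?thesis by (simp add: pairing_def sum_distrib_right sum_distrib_left mult_ac)
  qed
  then have "bracket_eval (z # xs) x y (\<lambda>g. fps_nth (c g) (Suc (Suc ?n)))
      = bracket_eval xs x y (\<lambda>g. pairing V \<alpha> z * fps_nth (c g) (Suc ?n))"
    unfolding bracket_eval.simps by (rule bracket_eval_cong)
  then show ?case by (simp add: bracket_eval_cmult Cons.IH bracket_form_def)
qed

lemma periodic_sum_shift:
  fixes f :: "nat \<Rightarrow> complex"
  assumes "\<And>i. f (i + m) = f i"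
  shows "(\<Sum>j<m. f (i + j)) = (\<Sum>j<m. f j)"
proof (induction i)
  case (Suc i)
  have "(\<Sum>j<m. f (Suc i + j)) + f i = (\<Sum>j<Suc m. f (i + j))"
    unfolding sum.lessThan_Suc_shift by simp
  also have "\<dots> = (\<Sum>j<m. f (i + j)) + f (i + m)" by simp
  finally show ?case using Suc assms[of i] by simp
qed simp

text \<open>Let \<open>L\<close> be the sum over \<open>j < m\<close> of the bracket evaluations
  after \<open>\<phi> ^^ j\<close>. By periodicity \<open>L(p(T) f) = p(1) L(f)\<close> for the
  operator \<open>T\<close> of composition with \<open>\<phi>\<close>. As
  \<open>L(f) \<noteq> 0\<close>, every polynomial annihilating \<open>f\<close> on the kernel has
  the root 1, and \<open>fixed_combination\<close> yields \<open>F\<close>.\<close>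

lemma fixed_hom_on_ab_ker:
  assumes \<phi>: "\<phi> \<in> hom G G" and perp: "perp \<alpha> \<beta>"
    and per: "\<And>i. bracket_form (pullback (\<phi> ^^ (i + m)) \<alpha>) (pullback (\<phi> ^^ (i + m)) \<beta>) xs x y
      = bracket_form (pullback (\<phi> ^^ i) \<alpha>) (pullback (\<phi> ^^ i) \<beta>) xs x y"
    and nz: "(\<Sum>j<m. bracket_form (pullback (\<phi> ^^ j) \<alpha>) (pullback (\<phi> ^^ j) \<beta>) xs x y) \<noteq> 0"
  shows "\<exists>F. (\<forall>g\<in>ab_ker. \<forall>h\<in>ab_ker. F (g \<otimes> h) = F g + (F h :: complex)) \<and> (\<exists>g\<in>ab_ker. F g \<noteq> 0)
    \<and> (\<forall>g\<in>ab_ker. F (\<phi> g) = F g)"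
proof -
  obtain c where c: "cocycle \<alpha> c" "\<And>g. g \<in> carrier G \<Longrightarrow> fps_nth (c g) 0 = hom_of \<beta> g"
    using perp_cocycle[OF perp] by blast
  define f where "f g = fps_nth (c g) (Suc (length xs))" for g
  define Zi where "Zi i = bracket_form (pullback (\<phi> ^^ i) \<alpha>) (pullback (\<phi> ^^ i) \<beta>) xs x y" for i
  note hom = hom_funpow[OF \<phi>]
  have bracket_eval: "bracket_eval xs x y (\<lambda>g. f ((\<phi> ^^ i) g)) = Zi i" for i
  proof -
    have "bracket_eval xs x y (\<lambda>g. f ((\<phi> ^^ i) g))
        = bracket_form (pullback (\<phi> ^^ i) \<alpha>) (\<lambda>v. fps_nth (c ((\<phi> ^^ i) (gen v))) 0) xs x y"
      unfolding f_def using bracket_eval_cocycle[OF cocycle_comp[OF hom c(1)]] .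
    also have "\<dots> = Zi i"
      using c(2) hom_in_carrier[OF hom] gen_closed
      by (simp add: Zi_def bracket_form_def pairing_def pullback_def[of _ \<beta>])
    finally show ?thesis .
  qed
  have kerp: "(\<phi> ^^ j) g \<in> ab_ker" if "g \<in> ab_ker" for g j using ab_ker_hom[OF hom that] .
  have "\<exists>p. p \<noteq> 0 \<and> (\<forall>g\<in>carrier G. iterate_comb \<phi> f p g = 0)"
    unfolding f_def by (rule poly_le_dependent[OF \<phi> poly_le_cocycle_nth[OF c(1)]])
  then obtain p\<^sub>0 where p0: "p\<^sub>0 \<noteq> 0" "\<And>g. g \<in> ab_ker \<Longrightarrow> iterate_comb \<phi> f p\<^sub>0 g = 0"
    by (auto simp: ab_ker_def)
  have "poly p 1 = 0" if p: "\<And>g. g \<in> ab_ker \<Longrightarrow> iterate_comb \<phi> f p g = 0" for p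
  proof -
    have "(\<Sum>i\<le>degree p. coeff p i * Zi (i + j)) = 0" for j
    proof -
      have "(\<Sum>i\<le>degree p. coeff p i * Zi (i + j))
          = bracket_eval xs x y (\<lambda>g. \<Sum>i\<le>degree p. coeff p i * f ((\<phi> ^^ (i + j)) g))"
        unfolding bracket_eval_sum bracket_eval ..
      also have "\<dots> = bracket_eval xs x y (\<lambda>g. iterate_comb \<phi> f p ((\<phi> ^^ j) g))"
        by (simp add: iterate_comb_def funpow_add)
      also have "\<dots> = bracket_eval xs x y (\<lambda>g. 0 * f g)"
        by (rule bracket_eval_cong) (use p kerp nested_ab_ker in simp)
      finally show ?thesis unfolding bracket_eval_cmult by simp
    qed
    then have "0 = (\<Sum>j<m. \<Sum>i\<le>degree p. coeff p i * Zi (i + j))" by simp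
    also have "\<dots> = (\<Sum>i\<le>degree p. coeff p i * (\<Sum>j<m. Zi (i + j)))"
      unfolding sum_distrib_left by (rule sum.swap)
    also have "\<dots> = (\<Sum>i\<le>degree p. coeff p i * (\<Sum>j<m. Zi j))"
      using periodic_sum_shift[of Zi m] per by (simp add: Zi_def)
    also have "\<dots> = poly p 1 * (\<Sum>j<m. Zi j)"
      by (simp add: poly_altdef sum_distrib_right)
    finally show ?thesis using nz by (simp add: Zi_def)
  qed
  from fixed_combination[OF p0 this]
  obtain q where q: "\<exists>g\<in>ab_ker. iterate_comb \<phi> f q g \<noteq> 0" "\<forall>g\<in>ab_ker. iterate_comb \<phi> f q (\<phi> g) = iterate_comb \<phi> f q g"
    by blast
  have "iterate_comb \<phi> f q (g \<otimes> h) = iterate_comb \<phi> f q g + iterate_comb \<phi> f q h" if gh: "g \<in> ab_ker" "h \<in> ab_ker" for g h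
  proof -
    \<comment> \<open>On \<open>ab_ker\<close> the exponential factor in the cocycle law is 1, so
      \<open>c\<close> is additive there.\<close>
    have "f ((\<phi> ^^ i) (g \<otimes> h)) = f ((\<phi> ^^ i) g) + f ((\<phi> ^^ i) h)" for i
    proof -
      have k: "(\<phi> ^^ i) g \<in> ab_ker" "(\<phi> ^^ i) h \<in> ab_ker" using kerp gh by auto
      have "(\<phi> ^^ i) (g \<otimes> h) = (\<phi> ^^ i) g \<otimes> (\<phi> ^^ i) h"
        using hom_mult[OF hom] gh by (simp add: ab_ker_def)
      moreover have "c ((\<phi> ^^ i) g \<otimes> (\<phi> ^^ i) h) = c ((\<phi> ^^ i) g) + c ((\<phi> ^^ i) h)"
        using k c(1) hom_of_ab_ker[OF k(1), of \<alpha>] by (simp add: cocycle_def ab_ker_def)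
      ultimately show ?thesis by (simp add: f_def)
    qed
    then show ?thesis by (simp add: iterate_comb_def sum.distrib algebra_simps)
  qed
  with q show ?thesis by blast
qed

text \<open>
  Either \<open>\<phi>\<close> fixes a nontrivial element of the abelianization, and then it also fixes a nonzero
  homomorphism \<open>G \<rightarrow> \<complex>\<close>; or \<open>x = g y \<phi>(g)\<inverse>\<close> with \<open>x, y \<in> ab_ker\<close> forces \<open>g \<in> ab_ker\<close>.
\<close>

lemma reidemeister_infinite_if_fixed_hom:
  assumes \<phi>: "\<phi> \<in> hom G G"
    and F: "\<And>g h. \<lbrakk>g \<in> ab_ker; h \<in> ab_ker\<rbrakk> \<Longrightarrow> F (g \<otimes> h) = F g + (F h :: complex)"
    and nz: "x\<^sub>0 \<in> ab_ker" "F x\<^sub>0 \<noteq> 0" and fixed: "\<And>g. g \<in> ab_ker \<Longrightarrow> F (\<phi> g) = F g"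
  shows "reidemeister_number G \<phi> = \<infinity>"
proof (cases "\<exists>g\<in>carrier G. g \<notin> ab_ker \<and> (\<forall>v\<in>V. ex v (\<phi> g) = ex v g)")
  case False
  show ?thesis
  proof (rule infinite_reidemeister[OF \<phi> subgroup_ab_ker _ F fixed nz])
    show "\<phi> ` ab_ker \<subseteq> ab_ker" using ab_ker_hom[OF \<phi>] by auto
    fix g x y assume g: "g \<in> carrier G" and xy: "x \<in> ab_ker" "y \<in> ab_ker" "x = g \<otimes> y \<otimes> inv (\<phi> g)"
    have pg: "\<phi> g \<in> carrier G" using hom_in_carrier[OF \<phi> g] .
    have "ex v (\<phi> g) = ex v g" if v: "v \<in> V" for v
    proof -
      have y: "y \<in> carrier G" "ex v y = 0" and x0: "ex v x = 0" using xy(1,2) v by (auto simp: ab_ker_def)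
      have "ex v x = ex v g + ex v y - ex v (\<phi> g)"
        unfolding xy(3) using g pg y(1) by (simp add: ex_mult ex_inv)
      then show ?thesis using x0 y(2) by simp
    qed
    then show "g \<in> ab_ker" using False g by blast
  qed
next
  case True
  then obtain g v where g: "g \<in> carrier G" "\<And>v. v \<in> V \<Longrightarrow> ex v (\<phi> g) = ex v g"
    and v: "v \<in> V" "ex v g \<noteq> 0"
    by (auto simp: ab_ker_def)
  note hom = hom_funpow[OF \<phi>]
  \<comment> \<open>\<open>\<alpha>\<close> is a coordinate that does not vanish at
    \<open>g\<close>. As \<open>\<phi>\<close> fixes the image of \<open>g\<close> in the
    abelianization, evaluation at \<open>g\<close> is an invariant functional on the iterates of
    \<open>hom_of \<alpha>\<close>, and \<open>fixed_combination\<close> applies on the whole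
    group.\<close>
  define \<alpha> where "\<alpha> = (\<lambda>u. if u = v then 1 else (0::complex))"
  have hmg: "hom_of \<gamma> (\<phi> g) = hom_of \<gamma> g" for \<gamma> using g(2) by (simp add: hom_of_def pairing_def)
  have hmgi: "hom_of \<alpha> ((\<phi> ^^ i) g) = hom_of \<alpha> g" for i
  proof (induction i)
    case (Suc i)
    have "hom_of \<alpha> ((\<phi> ^^ Suc i) g) = hom_of \<alpha> ((\<phi> ^^ i) (\<phi> g))" by (simp add: funpow_swap1)
    also have "\<dots> = hom_of (pullback (\<phi> ^^ i) \<alpha>) (\<phi> g)"
      using hom_of_pullback[OF hom hom_in_carrier[OF \<phi> g(1)]] by simp
    also have "\<dots> = hom_of \<alpha> ((\<phi> ^^ i) g)" using hmg hom_of_pullback[OF hom g(1)] by simp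
    finally show ?case using Suc by simp
  qed simp
  have hnz: "hom_of \<alpha> g \<noteq> 0" using v hom_of_delta[OF v(1), of g] by (simp add: \<alpha>_def)
  obtain p\<^sub>0 where p0: "p\<^sub>0 \<noteq> 0" "\<And>x. x \<in> carrier G \<Longrightarrow> iterate_comb \<phi> (hom_of \<alpha>) p\<^sub>0 x = 0"
    using poly_le_dependent[OF \<phi> poly_le_hom_of] by blast
  have "poly p 1 = 0" if "\<And>x. x \<in> carrier G \<Longrightarrow> iterate_comb \<phi> (hom_of \<alpha>) p x = 0" for p
  proof -
    have "poly p 1 * hom_of \<alpha> g = iterate_comb \<phi> (hom_of \<alpha>) p g"
      by (simp add: iterate_comb_def hmgi poly_altdef sum_distrib_right)
    then show ?thesis using that[OF g(1)] hnz by simp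
  qed
  from fixed_combination[OF p0 this]
  obtain q where q: "\<exists>x\<in>carrier G. iterate_comb \<phi> (hom_of \<alpha>) q x \<noteq> 0"
    "\<forall>x\<in>carrier G. iterate_comb \<phi> (hom_of \<alpha>) q (\<phi> x) = iterate_comb \<phi> (hom_of \<alpha>) q x" by blast
  from q(1) obtain x where x: "x \<in> carrier G" "iterate_comb \<phi> (hom_of \<alpha>) q x \<noteq> 0" by blast
  show ?thesis
  proof (rule infinite_reidemeister[OF \<phi> subgroup_self _ _ q(2)[rule_format] x])
    show "\<phi> ` carrier G \<subseteq> carrier G" using hom_in_carrier[OF \<phi>] by auto
    show "iterate_comb \<phi> (hom_of \<alpha>) q (x \<otimes> y) = iterate_comb \<phi> (hom_of \<alpha>) q x + iterate_comb \<phi> (hom_of \<alpha>) q y"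
      if "x \<in> carrier G" "y \<in> carrier G" for x y
      using that hom_mult[OF hom] hom_in_carrier[OF hom]
      by (simp add: iterate_comb_def hom_of_mult sum.distrib algebra_simps)
  qed auto
qed

end

section \<open>Eigenvectors on twin classes\<close>

context raag_group
begin

lemma pullback_delta: "w \<in> V \<Longrightarrow> pullback \<phi> (\<lambda>u. if u = w then 1 else 0) v = of_int (ex w (\<phi> (gen v)))"
  by (simp add: pullback_def hom_of_delta)

lemma ex_hom:
  assumes "\<phi> \<in> hom G G" "w \<in> V" "h \<in> carrier G"
  shows "ex w (\<phi> h) = (\<Sum>v\<in>V. ex w (\<phi> (gen v)) * ex v h)"
proof -
  have "of_int (ex w (\<phi> h)) = hom_of (pullback \<phi> (\<lambda>u. if u = w then 1 else 0)) h"
    using assms by (simp add: hom_of_pullback hom_of_delta)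
  also have "\<dots> = of_int (\<Sum>v\<in>V. ex w (\<phi> (gen v)) * ex v h)"
    using assms(2) by (simp add: hom_of_def pairing_def pullback_delta)
  finally show ?thesis unfolding of_int_eq_iff .
qed

lemma pairing_cong: "(\<And>v. v \<in> V \<Longrightarrow> \<alpha> v = \<beta> v) \<Longrightarrow> pairing V \<alpha> x = pairing V \<beta> x"
  by (simp add: pairing_def)

lemma bracket_form_cong:
  assumes "\<And>v. v \<in> V \<Longrightarrow> \<alpha> v = \<alpha>' v" "\<And>v. v \<in> V \<Longrightarrow> \<beta> v = \<beta>' v"
  shows "bracket_form \<alpha> \<beta> xs x y = bracket_form \<alpha>' \<beta>' xs x y"
  using pairing_cong[OF assms(1)] pairing_cong[OF assms(2)] by (simp add: bracket_form_def cong: map_cong)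

lemma pairing_disjoint:
  assumes "supp \<alpha> \<subseteq> A" "supp x \<subseteq> B" "A \<inter> B = {}"
  shows "pairing V \<alpha> x = 0"
  unfolding pairing_def using assms by (intro sum.neutral) (auto simp: supp_def)

lemma pairing_subset:
  assumes "A \<subseteq> V" "supp x \<subseteq> A"
  shows "pairing V \<alpha> x = pairing A \<alpha> x"
  unfolding pairing_def using assms finite_V
  by (intro sum.mono_neutral_right) (auto simp: supp_def)

lemma pairing_lin: "pairing V (\<lambda>v. s * \<alpha> v + t * \<beta> v) x = s * pairing V \<alpha> x + t * pairing V \<beta> x"
  by (simp add: pairing_def sum.distrib sum_distrib_left algebra_simps)

lemma pairing_lin_right: "pairing V \<alpha> (\<lambda>v. s * x v + t * y v) = s * pairing V \<alpha> x + t * pairing V \<alpha> y"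
  by (simp add: pairing_def sum.distrib sum_distrib_left algebra_simps)

text \<open>An eigenvalue and an eigenvector of \<open>\<phi>\<close> on the complexified
  abelianization. The equation is stated by duality, against all functionals, since
  \<open>bracket_form\<close> sees vectors only through pairings.\<close>

definition eigen_on :: "('a \<Rightarrow> 'a) \<Rightarrow> 'v set \<Rightarrow> complex \<times> ('v \<Rightarrow> complex) \<Rightarrow> bool" where
  "eigen_on \<phi> A e \<longleftrightarrow> supp (snd e) \<noteq> {} \<and> supp (snd e) \<subseteq> A
     \<and> (\<forall>\<gamma>. pairing V (pullback \<phi> \<gamma>) (snd e) = fst e * pairing V \<gamma> (snd e))"

lemma eigen_on_prod:
  assumes "\<And>e. e \<in> set es \<Longrightarrow> \<exists>A. eigen_on \<phi> A e"
  shows "prod_list (map (pairing V (pullback \<phi> \<gamma>)) (map snd es))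
    = prod_list (map fst es) * prod_list (map (pairing V \<gamma>) (map snd es))"
  using assms
proof (induction es)
  case (Cons e es)
  have IH: "prod_list (map (pairing V (pullback \<phi> \<gamma>)) (map snd es))
    = prod_list (map fst es) * prod_list (map (pairing V \<gamma>) (map snd es))"
    by (rule Cons.IH) (rule Cons.prems, simp)
  obtain A where "eigen_on \<phi> A e" using Cons.prems[of e] by auto
  then have "pairing V (pullback \<phi> \<gamma>) (snd e) = fst e * pairing V \<gamma> (snd e)" by (simp add: eigen_on_def)
  with IH show ?case by (simp add: mult_ac)
qed simp

end

context regular_raag_group
begin

text \<open>\<open>\<phi>\<close> preserves this class and carries the other classes to classes
  different from it, so the integer matrix \<open>K\<close> of \<open>\<phi>\<close> splits off the
  block of the class. The block of \<open>\<psi>\<close> inverts it over the integers, and the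
  vectors from \<open>integer_eigenpairs\<close> are extended by zero.\<close>

lemma block_eigenpairs:
  assumes aut: "aut \<phi> \<psi>" and a: "a \<in> V" and maps_support: "maps_support \<phi> (twins a) (twins a)"
  shows "\<exists>es. length es = card (twins a) \<and> (prod_list (map fst es))\<^sup>2 = 1
    \<and> (\<forall>e\<in>set es. eigen_on \<phi> (twins a) e)
    \<and> (2 \<le> card (twins a) \<longrightarrow> (\<exists>x y c. indep2 (twins a) x y \<and> eigen_on \<phi> (twins a) (fst (es ! 0), x)
        \<and> supp y \<subseteq> twins a
        \<and> (\<forall>\<gamma>. pairing V (pullback \<phi> \<gamma>) y = fst (es ! 1) * pairing V \<gamma> y + c * pairing V \<gamma> x)))"
proof -
  define A where "A = twins a"
  have AV: "A \<subseteq> V" using twins_subset by (simp add: A_def)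
  have finA: "finite A" using AV finite_V finite_subset by blast
  have hom: "\<phi> \<in> hom G G" "\<psi> \<in> hom G G" using aut by (auto simp: aut_def)
  define K where "K w v = ex w (\<phi> (gen v))" for w v
  define K' where "K' w v = ex w (\<psi> (gen v))" for w v
  define \<delta> :: "'c \<Rightarrow> 'c \<Rightarrow> complex" where "\<delta> w = (\<lambda>u. if u = w then 1 else 0)" for w
  have pullback_\<delta>: "pullback \<phi> (\<delta> w) v = of_int (K w v)" if "w \<in> V" for w v
    using that by (simp add: \<delta>_def K_def pullback_delta)
  have supp_\<delta>: "supp (\<delta> w) = {w}" if "w \<in> V" for w using that by (auto simp: supp_def \<delta>_def)
  have K_out: "K w v = 0" if "w \<in> A" "v \<in> V - A" for w v
  proof -
    have w: "w \<in> V" using that AV by auto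
    have "supp (pullback \<phi> (\<delta> w)) \<subseteq> A" using maps_support supp_\<delta>[OF w] that by (simp add: maps_support_def A_def)
    then have "pullback \<phi> (\<delta> w) v = 0" using that by (auto simp: supp_def)
    then show ?thesis using w by (simp add: pullback_\<delta>)
  qed
  have K_in: "K w v = 0" if w: "w \<in> V - A" and v: "v \<in> A" for w v
  proof -
    obtain c where c: "c \<in> V" "maps_support \<phi> (twins w) (twins c)" using maps_support_twins[OF aut] w by blast
    have "twins c \<inter> A = {}"
    proof (rule ccontr)
      assume "twins c \<inter> A \<noteq> {}"
      then have "twins c = twins a" using twins_disjoint[OF c(1) a] by (auto simp: A_def)
      then have "twins w = twins a" using maps_support_twins_inj[OF aut _ a a] c maps_support w by auto
      then show False using w twins_refl[of w] by (auto simp: A_def)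
    qed
    moreover have "supp (pullback \<phi> (\<delta> w)) \<subseteq> twins c"
      using c(2) supp_\<delta>[of w] w twins_refl by (auto simp: maps_support_def)
    ultimately have "pullback \<phi> (\<delta> w) v = 0" using v AV by (auto simp: supp_def)
    then show ?thesis using w by (simp add: pullback_\<delta>)
  qed
  have inv: "(\<Sum>v\<in>A. K w v * K' v w') = (if w = w' then 1 else 0)" if w: "w \<in> A" "w' \<in> A" for w w'
  proof -
    have V: "w \<in> V" "w' \<in> V" using w AV by auto
    have c: "gen w' \<in> carrier G" "\<psi> (gen w') \<in> carrier G"
      using gen_closed V hom_in_carrier[OF hom(2)] by auto
    have "(\<Sum>v\<in>A. K w v * K' v w') = (\<Sum>v\<in>V. K w v * K' v w')"
      using K_out w(1) AV finite_V by (intro sum.mono_neutral_left) auto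
    also have "\<dots> = ex w (\<phi> (\<psi> (gen w')))"
      using ex_hom[OF hom(1) V(1) c(2)] by (simp add: K_def K'_def)
    also have "\<dots> = (if w = w' then 1 else 0)" using aut c V by (simp add: aut_def ex_gen)
    finally show ?thesis .
  qed
  obtain evs where evs: "length evs = card A" "(prod_list (map fst evs))\<^sup>2 = 1"
    "list_all (eigenpair A K) evs"
    "2 \<le> card A \<Longrightarrow> \<exists>x y c. indep2 A x y \<and> eigenpair A K (fst (evs ! 0), x) \<and>
       (\<forall>w\<in>A. (\<Sum>v\<in>A. of_int (K w v) * y v) = fst (evs ! 1) * y w + c * x w)"
    using integer_eigenpairs[OF finA inv] by blast
  define z where "z x = (\<lambda>v. if v \<in> A then x v else (0::complex))" for x
  have supp_z: "supp (z x) \<subseteq> A" for x by (auto simp: supp_def z_def)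
  have act: "pairing V (pullback \<phi> \<gamma>) (z x) = pairing V \<gamma> (z y)"
    if xy: "\<And>w. w \<in> A \<Longrightarrow> (\<Sum>v\<in>A. of_int (K w v) * x v) = y w" for x y \<gamma>
  proof -
    have pullback: "pullback \<phi> \<gamma> v = (\<Sum>w\<in>V. \<gamma> w * of_int (K w v))" for v
      by (simp add: pullback_def hom_of_def pairing_def K_def)
    have "pairing V (pullback \<phi> \<gamma>) (z x) = (\<Sum>v\<in>A. pullback \<phi> \<gamma> v * x v)"
      unfolding pairing_subset[OF AV supp_z] by (simp add: pairing_def z_def)
    also have "\<dots> = (\<Sum>w\<in>V. \<gamma> w * (\<Sum>v\<in>A. of_int (K w v) * x v))"
      unfolding pullback sum_distrib_left sum_distrib_right
      by (subst sum.swap) (simp add: mult.assoc)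
    also have "\<dots> = (\<Sum>w\<in>V. \<gamma> w * z y w)"
    proof (intro sum.cong HOL.refl)
      fix w assume "w \<in> V"
      then show "\<gamma> w * (\<Sum>v\<in>A. of_int (K w v) * x v) = \<gamma> w * z y w"
        using xy K_in by (cases "w \<in> A") (auto simp: z_def)
    qed
    finally show ?thesis by (simp add: pairing_def)
  qed
  have eigen_on: "eigen_on \<phi> A (l, z x)" if "eigenpair A K (l, x)" for l x
  proof -
    have "(\<Sum>v\<in>A. of_int (K w v) * x v) = l * x w" if "w \<in> A" for w
      using \<open>eigenpair A K (l, x)\<close> that by (simp add: eigenpair_def)
    then have "pairing V (pullback \<phi> \<gamma>) (z x) = pairing V \<gamma> (z (\<lambda>w. l * x w))" for \<gamma> by (rule act)
    also have "pairing V \<gamma> (z (\<lambda>w. l * x w)) = l * pairing V \<gamma> (z x)" for \<gamma>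
      by (simp add: pairing_def z_def sum_distrib_left if_distrib mult_ac cong: if_cong)
    finally have "pairing V (pullback \<phi> \<gamma>) (z x) = l * pairing V \<gamma> (z x)" for \<gamma> .
    moreover have "supp (z x) \<noteq> {}" using that AV by (auto simp: eigenpair_def supp_def z_def)
    ultimately show ?thesis using supp_z by (simp add: eigen_on_def)
  qed
  define es where "es = map (\<lambda>e. (fst e, z (snd e))) evs"
  have es: "length es = card A" "map fst es = map fst evs" using evs(1) by (auto simp: es_def comp_def)
  have "eigen_on \<phi> A e" if "e \<in> set es" for e
    using that evs(3) eigen_on by (auto simp: es_def list_all_iff)
  moreover have "\<exists>x y c. indep2 A x y \<and> eigen_on \<phi> A (fst (es ! 0), x) \<and> supp y \<subseteq> A
        \<and> (\<forall>\<gamma>. pairing V (pullback \<phi> \<gamma>) y = fst (es ! 1) * pairing V \<gamma> y + c * pairing V \<gamma> x)" if c2: "2 \<le> card A"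
  proof -
    obtain x y c where xyc: "indep2 A x y" "eigenpair A K (fst (evs ! 0), x)"
       "\<And>w. w \<in> A \<Longrightarrow> (\<Sum>v\<in>A. of_int (K w v) * y v) = fst (evs ! 1) * y w + c * x w"
      using evs(4)[OF c2] by blast
    have nth: "fst (es ! 0) = fst (evs ! 0)" "fst (es ! 1) = fst (evs ! 1)"
      using c2 evs(1) by (auto simp: es_def)
    have "pairing V (pullback \<phi> \<gamma>) (z y) = fst (es ! 1) * pairing V \<gamma> (z y) + c * pairing V \<gamma> (z x)" for \<gamma>
    proof -
      have zeq: "z (\<lambda>w. fst (evs ! 1) * y w + c * x w) = (\<lambda>w. fst (evs ! 1) * z y w + c * z x w)"
        by (auto simp: z_def)
      show ?thesis using act[OF xyc(3), of \<gamma>] unfolding nth zeq pairing_lin_right .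
    qed
    moreover have "indep2 A (z x) (z y)"
    proof -
      have "(\<forall>v\<in>A. r * z x v + s * z y v = 0) = (\<forall>v\<in>A. r * x v + s * y v = 0)" for r s
        by (rule ball_cong) (simp_all add: z_def)
      then show ?thesis using xyc(1) unfolding indep2_def by blast
    qed
    ultimately show ?thesis using eigen_on[OF xyc(2)] supp_z unfolding nth by blast
  qed
  ultimately show ?thesis using es evs(2) unfolding A_def by metis
qed

lemma bracket_form_periodic:
  assumes \<phi>: "\<phi> \<in> hom G G"
    and inv: "\<And>\<gamma> \<delta>. bracket_form (pullback (\<phi> ^^ m) \<gamma>) (pullback (\<phi> ^^ m) \<delta>) xs x y = bracket_form \<gamma> \<delta> xs x y"
  shows "bracket_form (pullback (\<phi> ^^ (i + m)) \<alpha>) (pullback (\<phi> ^^ (i + m)) \<beta>) xs x y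
      = bracket_form (pullback (\<phi> ^^ i) \<alpha>) (pullback (\<phi> ^^ i) \<beta>) xs x y"
proof -
  have eq: "pullback (\<phi> ^^ (i + m)) \<gamma> v = pullback (\<phi> ^^ m) (pullback (\<phi> ^^ i) \<gamma>) v" if "v \<in> V" for \<gamma> v
    using pullback_comp[OF hom_funpow[OF \<phi>] hom_funpow[OF \<phi>] that] by (simp add: funpow_add)
  have "bracket_form (pullback (\<phi> ^^ (i + m)) \<alpha>) (pullback (\<phi> ^^ (i + m)) \<beta>) xs x y
    = bracket_form (pullback (\<phi> ^^ m) (pullback (\<phi> ^^ i) \<alpha>)) (pullback (\<phi> ^^ m) (pullback (\<phi> ^^ i) \<beta>)) xs x y"
    by (rule bracket_form_cong) (erule eq)+
  then show ?thesis by (simp only: inv)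
qed

section \<open>From non-adjacent vertices to infinite Reidemeister numbers\<close>

lemma reidemeister_infinite_if_bracket_form:
  assumes \<phi>: "\<phi> \<in> hom G G" and perp: "perp \<alpha> \<beta>"
    and inv: "\<And>\<gamma> \<delta>. bracket_form (pullback (\<phi> ^^ m) \<gamma>) (pullback (\<phi> ^^ m) \<delta>) xs x y = bracket_form \<gamma> \<delta> xs x y"
    and nz: "(\<Sum>j<m. bracket_form (pullback (\<phi> ^^ j) \<alpha>) (pullback (\<phi> ^^ j) \<beta>) xs x y) \<noteq> 0"
  shows "reidemeister_number G \<phi> = \<infinity>"
proof -
  obtain F where F: "\<forall>g\<in>ab_ker. \<forall>h\<in>ab_ker. F (g \<otimes> h) = F g + (F h :: complex)" "\<exists>g\<in>ab_ker. F g \<noteq> 0"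
    "\<forall>g\<in>ab_ker. F (\<phi> g) = F g"
    using fixed_hom_on_ab_ker[OF \<phi> perp bracket_form_periodic[OF \<phi> inv] nz] by blast
  from F(2) obtain g where "g \<in> ab_ker" "F g \<noteq> 0" by blast
  then show ?thesis
    using reidemeister_infinite_if_fixed_hom[OF \<phi>, of F] F(1,3) by blast
qed

lemma pullback_id: "v \<in> V \<Longrightarrow> pullback (\<phi> ^^ 0) \<alpha> v = \<alpha> v"
  by (simp add: pullback_def hom_of_gen)

lemma generic_on:
  assumes "A \<subseteq> V" "\<And>x. x \<in> set xs \<Longrightarrow> supp x \<noteq> {} \<and> supp x \<subseteq> A"
  shows "\<exists>\<alpha>. supp \<alpha> \<subseteq> A \<and> (\<forall>x\<in>set xs. pairing V \<alpha> x \<noteq> 0)"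
proof -
  have "\<exists>\<alpha>. \<forall>x\<in>set xs. pairing A \<alpha> x \<noteq> 0"
  proof (rule generic_functional)
    show "finite A" using assms(1) finite_V finite_subset by blast
    show "\<exists>v\<in>A. x v \<noteq> 0" if "x \<in> set xs" for x using assms(2)[OF that] by (auto simp: supp_def)
  qed
  then obtain \<alpha> where \<alpha>: "\<forall>x\<in>set xs. pairing A \<alpha> x \<noteq> 0" by blast
  define \<beta> where "\<beta> = (\<lambda>v. if v \<in> A then \<alpha> v else 0)"
  have "pairing V \<beta> x = pairing A \<alpha> x" if "x \<in> set xs" for x
    using pairing_subset[OF assms(1), of x \<beta>] assms(2)[OF that] by (simp add: pairing_def \<beta>_def)
  moreover have "supp \<beta> \<subseteq> A" by (auto simp: supp_def \<beta>_def)
  ultimately show ?thesis using \<alpha> by metis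
qed

text \<open>The equations from \<open>twins_iff\<close> carry an edge between twins of
  \<open>a\<close> and \<open>b\<close> back to an edge between \<open>a\<close> and
  \<open>b\<close>; \<open>v = b\<close> is a separate case. The classes may coincide, and then the
  class is an independent set.\<close>

lemma no_edges_between:
  assumes "a \<in> V" "b \<in> V" "a \<noteq> b" "\<not> adj a b" "v \<in> twins a" "w \<in> twins b"
  shows "\<not> adj v w"
proof
  assume vw: "adj v w"
  have V: "v \<in> V" "w \<in> V" using assms twins_subset by auto
  have 1: "nbhd v - {a} = nbhd a - {v}" and 2: "nbhd w - {b} = nbhd b - {w}"
    using assms V twins_iff by blast+
  have sym: "\<And>x y. x \<in> V \<Longrightarrow> y \<in> V \<Longrightarrow> x \<in> nbhd y \<longleftrightarrow> y \<in> nbhd x"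
    using adj_sym by (auto simp: nbhd_def)
  have nab: "b \<notin> nbhd a" "a \<notin> nbhd b" using assms(4) adj_sym by (auto simp: nbhd_def)
  have "w \<in> nbhd v" using vw V by (simp add: nbhd_def)
  have nbv: "b \<notin> nbhd v" using 1 nab(1) assms(3) by blast
  have "v \<in> nbhd w" using sym V \<open>w \<in> nbhd v\<close> by blast
  show False
  proof (cases "v = b")
    case True
    then show False using \<open>w \<in> nbhd v\<close> 1 2 nab nbv assms sym V adj_irrefl
      by (metis (no_types, lifting) DiffE DiffI insertCI insertE nbhd_def mem_Collect_eq singletonD)
  next
    case False
    then have "v \<in> nbhd b" using 2 \<open>v \<in> nbhd w\<close> by blast
    then show False using sym V assms(2) nbv by blast
  qed
qed

text \<open>The class \<open>A\<close> spans no edges, so all functionals supported in it are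
  perpendicular. With \<open>m\<close> the least period of \<open>A\<close>, the pullbacks of
  \<open>\<alpha>\<close> along \<open>\<phi> ^^ j\<close> for \<open>0 < j < m\<close> live on
  other classes, so only the summand \<open>j = 0\<close> survives.\<close>

lemma reidemeister_infinite_same_class:
  assumes aut: "aut \<phi> \<psi>" and ab: "a \<in> V" "b \<in> V" "a \<noteq> b" "\<not> adj a b" "twins a = twins b"
  shows "reidemeister_number G \<phi> = \<infinity>"
proof -
  define A where "A = twins a"
  have AV: "A \<subseteq> V" using twins_subset by (simp add: A_def)
  then have finA: "finite A" using finite_V finite_subset by blast
  have \<phi>: "\<phi> \<in> hom G G" using aut by (simp add: aut_def)
  have "{a, b} \<subseteq> A" using ab twins_refl by (auto simp: A_def)
  then have "card {a, b} \<le> card A" by (rule card_mono[OF finA])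
  then have card: "2 \<le> card A" using ab(3) by simp
  define P where "P m \<longleftrightarrow> m > 0 \<and> maps_support (\<phi> ^^ m) A A" for m
  define m where "m = (LEAST m. P m)"
  have "\<exists>m. P m" using maps_support_twins_period[OF aut ab(1,1)] by (auto simp: P_def A_def)
  then have Pm: "P m" unfolding m_def by (rule LeastI_ex)
  have minimal: "\<not> P j" if "j < m" for j
    using that unfolding m_def by (rule not_less_Least)
  note autm = aut_funpow[OF aut]
  have mapsA: "maps_support (\<phi> ^^ m) (twins a) (twins a)" using Pm by (simp add: P_def A_def)
  obtain es x y c where es: "length es = card A" "(prod_list (map fst es))\<^sup>2 = 1"
    "\<And>e. e \<in> set es \<Longrightarrow> eigen_on (\<phi> ^^ m) A e"
    and xy: "indep2 A x y" "eigen_on (\<phi> ^^ m) A (fst (es ! 0), x)" "supp y \<subseteq> A"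
    "\<And>\<gamma>. pairing V (pullback (\<phi> ^^ m) \<gamma>) y = fst (es ! 1) * pairing V \<gamma> y + c * pairing V \<gamma> x"
    using block_eigenpairs[OF autm ab(1) mapsA] card unfolding A_def[symmetric] by blast
  obtain e0 e1 rest where split: "es = e0 # e1 # rest"
    using card es(1) by (metis One_nat_def Suc_1 Suc_le_length_iff)
  \<comment> \<open>\<open>x\<close> and \<open>y\<close> stand for the first two entries of
    \<open>es\<close>, so every entry is used twice in total and the eigenvalue factor is the
    squared product of \<open>es\<close>, which is 1. The extra multiple \<open>c\<close> of
    \<open>x\<close> in the image of \<open>y\<close> does not change the determinant.\<close>
  define fs where "fs = rest @ es"
  define xs where "xs = map snd fs"
  have fs: "eigen_on (\<phi> ^^ m) A e" if "e \<in> set fs" for e using that es(3)[of e] by (auto simp: fs_def split)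
  have ex: "\<exists>A. eigen_on (\<phi> ^^ m) A e" if "e \<in> set fs" for e using fs[OF that] by blast
  have prod: "prod_list (map fst fs) * (fst e0 * fst e1) = 1"
    using es(2) by (simp add: fs_def split power2_eq_square mult_ac)
  have inv: "bracket_form (pullback (\<phi> ^^ m) \<gamma>) (pullback (\<phi> ^^ m) \<delta>) xs x y = bracket_form \<gamma> \<delta> xs x y" for \<gamma> \<delta>
  proof -
    have x: "pairing V (pullback (\<phi> ^^ m) \<gamma>) x = fst e0 * pairing V \<gamma> x" for \<gamma>
      using xy(2) by (simp add: eigen_on_def split)
    have y: "pairing V (pullback (\<phi> ^^ m) \<gamma>) y = fst e1 * pairing V \<gamma> y + c * pairing V \<gamma> x" for \<gamma>
      using xy(4) by (simp add: split)
    have "bracket_form (pullback (\<phi> ^^ m) \<gamma>) (pullback (\<phi> ^^ m) \<delta>) xs x y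
      = (prod_list (map fst fs) * (fst e0 * fst e1)) * bracket_form \<gamma> \<delta> xs x y"
      using eigen_on_prod[OF ex, where \<gamma> = \<gamma>] unfolding bracket_form_def xs_def x y by (simp add: algebra_simps)
    then show ?thesis using prod by simp
  qed
  have "supp z \<noteq> {} \<and> supp z \<subseteq> A" if "z \<in> set (x # xs)" for z
  proof (cases "z = x")
    case True
    then show ?thesis using xy(2) by (simp add: eigen_on_def)
  next
    case False
    then have "z \<in> snd ` set fs" using that by (simp add: xs_def)
    then obtain e where "e \<in> set fs" "z = snd e" by blast
    then show ?thesis using fs[of e] by (simp add: eigen_on_def)
  qed
  from generic_on[OF AV this]
  have "\<exists>\<alpha>. supp \<alpha> \<subseteq> A \<and> (\<forall>z\<in>set (x # xs). pairing V \<alpha> z \<noteq> 0)" .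
  then obtain \<alpha> where \<alpha>: "supp \<alpha> \<subseteq> A" "\<And>z. z \<in> set (x # xs) \<Longrightarrow> pairing V \<alpha> z \<noteq> 0" by blast
  \<comment> \<open>\<open>\<beta>(u)\<close> is the determinant
    \<open>\<alpha>(x) \<beta>(y) - \<alpha>(y) \<beta>(x)\<close>. Independence of \<open>x\<close>
    and \<open>y\<close> together with \<open>\<alpha>(x) \<noteq> 0\<close> makes \<open>u\<close>
    nonzero, so a suitable \<open>\<beta>\<close> exists.\<close>
  define u where "u = (\<lambda>v. pairing V \<alpha> x * y v + (- pairing V \<alpha> y) * x v)"
  have suppx: "supp x \<subseteq> A" using xy(2) by (simp add: eigen_on_def)
  have suppu: "supp u \<subseteq> A"
  proof
    fix v assume v: "v \<in> supp u"
    then have "x v \<noteq> 0 \<or> y v \<noteq> 0" by (auto simp: supp_def u_def)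
    then show "v \<in> A" using v suppx xy(3) by (auto simp: supp_def)
  qed
  have "supp u \<noteq> {}"
  proof
    assume "supp u = {}"
    then have "(- pairing V \<alpha> y) * x v + pairing V \<alpha> x * y v = 0" if "v \<in> A" for v
      using that AV by (auto simp: supp_def u_def add.commute)
    then have "pairing V \<alpha> x = 0" using xy(1) unfolding indep2_def by blast
    then show False using \<alpha>(2) by simp
  qed
  then have "\<exists>\<beta>. supp \<beta> \<subseteq> A \<and> (\<forall>z\<in>set [u]. pairing V \<beta> z \<noteq> 0)"
    using suppu by (intro generic_on AV) auto
  then obtain \<beta> where \<beta>: "supp \<beta> \<subseteq> A" "pairing V \<beta> u \<noteq> 0" by auto
  have perp: "perp \<alpha> \<beta>"
    unfolding perp_def
  proof (intro ballI impI)
    fix v w assume vw: "v \<in> V" "w \<in> V" "adj v w"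
    then have "\<not> (v \<in> A \<and> w \<in> A)" using no_edges_between[OF ab(1-4)] ab(5) by (auto simp: A_def)
    moreover have "\<alpha> u = 0" "\<beta> u = 0" if "u \<in> V" "u \<notin> A" for u
      using \<alpha>(1) \<beta>(1) that by (auto simp: supp_def)
    ultimately show "\<alpha> v * \<beta> w = \<alpha> w * \<beta> v"
      using vw(1,2) by (cases "v \<in> A") auto
  qed
  have Z0: "bracket_form \<alpha> \<beta> xs x y \<noteq> 0"
  proof -
    have "pairing V \<alpha> x * pairing V \<beta> y - pairing V \<alpha> y * pairing V \<beta> x = pairing V \<beta> u"
      unfolding u_def pairing_lin_right by simp
    then show ?thesis using \<beta>(2) \<alpha>(2) by (auto simp: bracket_form_def prod_list_zero_iff)
  qed
  have Zj: "bracket_form (pullback (\<phi> ^^ j) \<alpha>) (pullback (\<phi> ^^ j) \<beta>) xs x y = 0" if j: "j \<in> {..<m} - {0}" for j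
  proof -
    obtain d where d: "d \<in> V" "maps_support (\<phi> ^^ j) A (twins d)"
      using maps_support_twins[OF autm ab(1)] unfolding A_def by blast
    have "twins d \<noteq> A" using minimal[of j] j d(2) by (auto simp: P_def)
    then have dis: "twins d \<inter> A = {}" using twins_disjoint[OF d(1) ab(1)] by (auto simp: A_def)
    have "supp (pullback (\<phi> ^^ j) \<alpha>) \<subseteq> twins d" using d(2) \<alpha>(1) by (simp add: maps_support_def)
    then show ?thesis using pairing_disjoint[OF _ _ dis] suppx xy(3) by (simp add: bracket_form_def)
  qed
  have "(\<Sum>j<m. bracket_form (pullback (\<phi> ^^ j) \<alpha>) (pullback (\<phi> ^^ j) \<beta>) xs x y)
      = bracket_form (pullback (\<phi> ^^ 0) \<alpha>) (pullback (\<phi> ^^ 0) \<beta>) xs x y"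
    using Pm Zj by (subst sum.remove[of _ 0]) (auto simp: P_def)
  also have "\<dots> = bracket_form \<alpha> \<beta> xs x y" by (rule bracket_form_cong) (simp_all add: pullback_id del: funpow.simps)
  finally show ?thesis using reidemeister_infinite_if_bracket_form[OF \<phi> perp inv] Z0 by metis
qed

lemma prod_list_scale:
  fixes f g :: "'z \<Rightarrow> complex"
  assumes "\<And>z. z \<in> set zs \<Longrightarrow> f z = s * g z"
  shows "prod_list (map f zs) = s ^ length zs * prod_list (map g zs)"
  using assms by (induction zs) auto

text \<open>No edge joins \<open>A\<close> and \<open>B\<close>, so
  \<open>s \<alpha>A + \<alpha>B\<close> is perpendicular to \<open>\<alpha>A\<close> for every
  \<open>s\<close>. In the orbit sum, \<open>j = 0\<close> contributes a nonzero multiple of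
  \<open>s ^ p\<close>, a power of \<open>\<phi>\<close> exchanging the classes a multiple of
  \<open>s ^ q\<close>, and any other power zero. As \<open>p \<noteq> q\<close>, the sum is nonzero
  for some \<open>s\<close>.\<close>

lemma reidemeister_infinite_distinct_classes:
  assumes aut: "aut \<phi> \<psi>" and ab: "a \<in> V" "b \<in> V" "a \<noteq> b" "\<not> adj a b" "twins a \<noteq> twins b"
  shows "reidemeister_number G \<phi> = \<infinity>"
proof -
  define A B where "A = twins a" and "B = twins b"
  have V: "A \<subseteq> V" "B \<subseteq> V" using twins_subset by (auto simp: A_def B_def)
  then have fin: "finite A" "finite B" using finite_V finite_subset by auto
  have AB: "A \<inter> B = {}" using twins_disjoint[OF ab(1,2)] ab(5) by (auto simp: A_def B_def)
  have \<phi>: "\<phi> \<in> hom G G" using aut by (simp add: aut_def)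
  have "a \<in> A" "b \<in> B" using ab twins_refl by (auto simp: A_def B_def)
  then have card: "1 \<le> card A" "1 \<le> card B" using fin by (auto simp: Suc_le_eq card_gt_0_iff)
  define P where "P m \<longleftrightarrow> m > 0 \<and> maps_support (\<phi> ^^ m) A A \<and> maps_support (\<phi> ^^ m) B B" for m
  define m where "m = (LEAST m. P m)"
  have "\<exists>m. P m" using maps_support_twins_period[OF aut ab(1,2)] by (auto simp: P_def A_def B_def)
  then have Pm: "P m" unfolding m_def by (rule LeastI_ex)
  have minimal: "\<not> P j" if "j < m" for j
    using that unfolding m_def by (rule not_less_Least)
  note autm = aut_funpow[OF aut]
  have mapsA: "maps_support (\<phi> ^^ m) (twins a) (twins a)" and mapsB: "maps_support (\<phi> ^^ m) (twins b) (twins b)"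
    using Pm by (simp_all add: P_def A_def B_def)
  obtain es where es: "length es = card A" "(prod_list (map fst es))\<^sup>2 = 1"
    "\<And>e. e \<in> set es \<Longrightarrow> eigen_on (\<phi> ^^ m) A e"
    using block_eigenpairs[OF autm ab(1) mapsA] unfolding A_def[symmetric] by blast
  obtain fs where fs: "length fs = card B" "(prod_list (map fst fs))\<^sup>2 = 1"
    "\<And>e. e \<in> set fs \<Longrightarrow> eigen_on (\<phi> ^^ m) B e"
    using block_eigenpairs[OF autm ab(2) mapsB] unfolding B_def[symmetric] by blast
  obtain e0 es' where es': "es = e0 # es'" using card(1) es(1) by (cases es) auto
  obtain f0 fs' where fs': "fs = f0 # fs'" using card(2) fs(1) by (cases fs) auto
  define ga where "ga = es' @ es"
  \<comment> \<open>Counting \<open>x\<close> and \<open>y\<close>, the lists \<open>es\<close> and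
    \<open>fs\<close> are each used an even number of times, so the eigenvalue factor is 1. For
    classes of equal size the two extra copies of \<open>fs\<close> keep \<open>p\<close> and
    \<open>q\<close> apart.\<close>
  define gb where "gb = fs' @ fs @ (if card A = card B then fs @ fs else [])"
  define p q where "p = length ga" and "q = length gb"
  have pq: "p \<noteq> q" using es(1) fs(1) by (auto simp: p_def q_def ga_def gb_def es' fs')
  define x y where "x = snd e0" and "y = snd f0"
  define xs where "xs = map snd (ga @ gb)"
  have ga: "eigen_on (\<phi> ^^ m) A e" if "e \<in> set ga" for e using that es(3)[of e] by (auto simp: ga_def es')
  have gb: "eigen_on (\<phi> ^^ m) B e" if "e \<in> set gb" for e
    using that fs(3)[of e] by (auto simp: gb_def fs' split: if_splits)
  have e0: "eigen_on (\<phi> ^^ m) A e0" and f0: "eigen_on (\<phi> ^^ m) B f0" using es(3)[of e0] fs(3)[of f0] by (auto simp: es' fs')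
  have prod: "prod_list (map fst (ga @ gb)) * (fst e0 * fst f0) = 1"
  proof -
    have "prod_list (map fst (ga @ gb)) * (fst e0 * fst f0)
       = (prod_list (map fst es))\<^sup>2 * (prod_list (map fst fs))\<^sup>2 *
         (if card A = card B then (prod_list (map fst fs))\<^sup>2 else 1)"
      by (simp add: ga_def gb_def es' fs' power2_eq_square mult_ac)
    then show ?thesis using es(2) fs(2) by simp
  qed
  have inv: "bracket_form (pullback (\<phi> ^^ m) \<gamma>) (pullback (\<phi> ^^ m) \<delta>) xs x y = bracket_form \<gamma> \<delta> xs x y" for \<gamma> \<delta>
  proof -
    have x: "pairing V (pullback (\<phi> ^^ m) \<gamma>) x = fst e0 * pairing V \<gamma> x" for \<gamma>
      using e0 by (simp add: eigen_on_def x_def)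
    have y: "pairing V (pullback (\<phi> ^^ m) \<gamma>) y = fst f0 * pairing V \<gamma> y" for \<gamma>
      using f0 by (simp add: eigen_on_def y_def)
    have "\<exists>A. eigen_on (\<phi> ^^ m) A e" if "e \<in> set (ga @ gb)" for e using that ga[of e] gb[of e] by auto
    from eigen_on_prod[OF this] have "bracket_form (pullback (\<phi> ^^ m) \<gamma>) (pullback (\<phi> ^^ m) \<delta>) xs x y
      = (prod_list (map fst (ga @ gb)) * (fst e0 * fst f0)) * bracket_form \<gamma> \<delta> xs x y"
      unfolding bracket_form_def xs_def x y by (simp add: algebra_simps)
    then show ?thesis using prod by simp
  qed
  have eigA: "eigen_on (\<phi> ^^ m) A e" if "e \<in> set (e0 # ga)" for e using that e0 ga[of e] by auto
  have suppA: "supp (snd e) \<subseteq> A" if "e \<in> set (e0 # ga)" for e using eigA[OF that] by (simp add: eigen_on_def)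
  have eigB: "eigen_on (\<phi> ^^ m) B e" if "e \<in> set (f0 # gb)" for e using that f0 gb[of e] by auto
  have suppB: "supp (snd e) \<subseteq> B" if "e \<in> set (f0 # gb)" for e using eigB[OF that] by (simp add: eigen_on_def)
  have supp_xy: "supp x \<subseteq> A" "supp y \<subseteq> B" using suppA[of e0] suppB[of f0] by (auto simp: x_def y_def)
  have "\<exists>\<alpha>. supp \<alpha> \<subseteq> A \<and> (\<forall>z\<in>set (map snd (e0 # ga)). pairing V \<alpha> z \<noteq> 0)"
  proof (rule generic_on)
    fix z assume "z \<in> set (map snd (e0 # ga))"
    then obtain e where "e \<in> set (e0 # ga)" "z = snd e" unfolding set_map by blast
    then show "supp z \<noteq> {} \<and> supp z \<subseteq> A" using eigA[of e] by (simp add: eigen_on_def)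
  qed (rule V)
  then obtain \<alpha>A where \<alpha>A: "supp \<alpha>A \<subseteq> A" "\<And>e. e \<in> set (e0 # ga) \<Longrightarrow> pairing V \<alpha>A (snd e) \<noteq> 0"
    unfolding set_map by blast
  have "\<exists>\<alpha>. supp \<alpha> \<subseteq> B \<and> (\<forall>z\<in>set (map snd (f0 # gb)). pairing V \<alpha> z \<noteq> 0)"
  proof (rule generic_on)
    fix z assume "z \<in> set (map snd (f0 # gb))"
    then obtain e where "e \<in> set (f0 # gb)" "z = snd e" unfolding set_map by blast
    then show "supp z \<noteq> {} \<and> supp z \<subseteq> B" using eigB[of e] by (simp add: eigen_on_def)
  qed (rule V)
  then obtain \<alpha>B where \<alpha>B: "supp \<alpha>B \<subseteq> B" "\<And>e. e \<in> set (f0 # gb) \<Longrightarrow> pairing V \<alpha>B (snd e) \<noteq> 0"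
    unfolding set_map by blast
  define \<alpha> where "\<alpha> s = (\<lambda>v. s * \<alpha>A v + 1 * \<alpha>B v)" for s
  have perp: "perp (\<alpha> s) \<alpha>A" for s
    unfolding perp_def
  proof (intro ballI impI)
    fix v w assume vw: "v \<in> V" "w \<in> V" "adj v w"
    then have "\<not> (v \<in> A \<and> w \<in> B)" "\<not> (w \<in> A \<and> v \<in> B)"
      using no_edges_between[OF ab(1-4)] adj_sym by (auto simp: A_def B_def)
    moreover have "\<alpha>A u = 0" if "u \<in> V" "u \<notin> A" for u using \<alpha>A(1) that by (auto simp: supp_def)
    moreover have "\<alpha>B u = 0" if "u \<in> V" "u \<notin> B" for u using \<alpha>B(1) that by (auto simp: supp_def)
    ultimately show "\<alpha> s v * \<alpha>A w = \<alpha> s w * \<alpha>A v"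
      using AB vw(1,2) unfolding \<alpha>_def
      by (cases "v \<in> A"; cases "w \<in> A") (auto simp: disjoint_iff)
  qed
  define Zj where "Zj j s = bracket_form (pullback (\<phi> ^^ j) (\<alpha> s)) (pullback (\<phi> ^^ j) \<alpha>A) xs x y" for j s
  have BA: "B \<inter> A = {}" using AB by blast
  have bracket_form_split: "bracket_form \<gamma> \<delta> xs x y = prod_list (map (\<lambda>e. pairing V \<gamma> (snd e)) ga) *
      prod_list (map (\<lambda>e. pairing V \<gamma> (snd e)) gb) *
      (pairing V \<gamma> x * pairing V \<delta> y - pairing V \<gamma> y * pairing V \<delta> x)" for \<gamma> \<delta>
    by (simp add: bracket_form_def xs_def comp_def)
  have pj: "pairing V (pullback (\<phi> ^^ j) (\<alpha> s)) z
      = s * pairing V (pullback (\<phi> ^^ j) \<alpha>A) z + pairing V (pullback (\<phi> ^^ j) \<alpha>B) z" for j s z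
  proof -
    have "pullback (\<phi> ^^ j) (\<alpha> s) = (\<lambda>v. s * pullback (\<phi> ^^ j) \<alpha>A v + 1 * pullback (\<phi> ^^ j) \<alpha>B v)"
      unfolding \<alpha>_def using pullback_lin by blast
    then show ?thesis by (simp only: pairing_lin) simp
  qed
  have Z0: "Zj 0 s = s ^ p * Zj 0 1" "Zj 0 1 \<noteq> 0" for s
  proof -
    have pairing_0: "pairing V (pullback (\<phi> ^^ 0) \<gamma>) z = pairing V \<gamma> z" for \<gamma> z
      by (rule pairing_cong) (rule pullback_id)
    have A: "pairing V (pullback (\<phi> ^^ 0) (\<alpha> s)) (snd e) = s * pairing V \<alpha>A (snd e)" if "e \<in> set (e0 # ga)" for e s
      using pairing_disjoint[OF \<alpha>B(1) suppA[OF that] BA] unfolding pj pairing_0 by simp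
    have B: "pairing V (pullback (\<phi> ^^ 0) (\<alpha> s)) (snd e) = pairing V \<alpha>B (snd e)" if "e \<in> set (f0 # gb)" for e s
      using pairing_disjoint[OF \<alpha>A(1) suppB[OF that] AB] unfolding pj pairing_0 by simp
    have y: "pairing V \<alpha>A y = 0" using pairing_disjoint[OF \<alpha>A(1) supp_xy(2) AB] .
    have 1: "prod_list (map (\<lambda>e. pairing V (pullback (\<phi> ^^ 0) (\<alpha> s)) (snd e)) ga)
       = s ^ p * prod_list (map (\<lambda>e. pairing V \<alpha>A (snd e)) ga)" for s
      unfolding p_def by (rule prod_list_scale) (rule A, simp)
    have 2: "prod_list (map (\<lambda>e. pairing V (pullback (\<phi> ^^ 0) (\<alpha> s)) (snd e)) gb)
       = prod_list (map (\<lambda>e. pairing V \<alpha>B (snd e)) gb)" for s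
      by (intro arg_cong[where f = prod_list] map_cong HOL.refl B) simp
    have By: "pairing V (pullback (\<phi> ^^ 0) (\<alpha> s)) y = pairing V \<alpha>B y" for s
      unfolding y_def by (rule B) simp
    have "Zj 0 s = s ^ p * (prod_list (map (\<lambda>e. pairing V \<alpha>A (snd e)) ga) *
       prod_list (map (\<lambda>e. pairing V \<alpha>B (snd e)) gb) * (- (pairing V \<alpha>B y * pairing V \<alpha>A x)))" for s
      unfolding Zj_def bracket_form_split 1 2 By unfolding pairing_0 y by simp
    moreover have "prod_list (map (\<lambda>e. pairing V \<alpha>A (snd e)) ga) *
       prod_list (map (\<lambda>e. pairing V \<alpha>B (snd e)) gb) * (- (pairing V \<alpha>B y * pairing V \<alpha>A x)) \<noteq> 0"
    proof -
      have "0 \<notin> set (map (\<lambda>e. pairing V \<alpha>A (snd e)) ga)" "0 \<notin> set (map (\<lambda>e. pairing V \<alpha>B (snd e)) gb)"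
        using \<alpha>A(2) \<alpha>B(2) unfolding set_map image_iff by (metis list.set_intros(2))+
      then show ?thesis
        using \<alpha>A(2)[of e0] \<alpha>B(2)[of f0] by (simp add: prod_list_zero_iff x_def y_def)
    qed
    ultimately show "Zj 0 s = s ^ p * Zj 0 1" "Zj 0 1 \<noteq> 0" by simp_all
  qed
  have Zq: "Zj j s = s ^ q * Zj j 1" if j: "j \<in> {..<m} - {0}" for j s
  proof -
    obtain c where c: "c \<in> V" "maps_support (\<phi> ^^ j) A (twins c)"
      using maps_support_twins[OF autm ab(1)] unfolding A_def by blast
    obtain d where d: "d \<in> V" "maps_support (\<phi> ^^ j) B (twins d)"
      using maps_support_twins[OF autm ab(2)] unfolding B_def by blast
    define \<gamma>A \<gamma>B where "\<gamma>A = pullback (\<phi> ^^ j) \<alpha>A" and "\<gamma>B = pullback (\<phi> ^^ j) \<alpha>B"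
    have \<gamma>A: "supp \<gamma>A \<subseteq> twins c" and \<gamma>B: "supp \<gamma>B \<subseteq> twins d"
      using c(2) d(2) \<alpha>A(1) \<alpha>B(1) by (auto simp: maps_support_def \<gamma>A_def \<gamma>B_def)
    have dis: "twins u \<inter> A = {}" if "u \<in> V" "twins u \<noteq> A" for u
      using twins_disjoint[OF that(1) ab(1)] that(2) by (auto simp: A_def)
    have disB: "twins u \<inter> B = {}" if "u \<in> V" "twins u \<noteq> B" for u
      using twins_disjoint[OF that(1) ab(2)] that(2) by (auto simp: B_def)
    have Zs: "Zj j s = prod_list (map (\<lambda>e. s * pairing V \<gamma>A (snd e) + pairing V \<gamma>B (snd e)) ga) *
      prod_list (map (\<lambda>e. s * pairing V \<gamma>A (snd e) + pairing V \<gamma>B (snd e)) gb) *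
      ((s * pairing V \<gamma>A x + pairing V \<gamma>B x) * pairing V \<gamma>A y - (s * pairing V \<gamma>A y + pairing V \<gamma>B y) * pairing V \<gamma>A x)" for s
      unfolding Zj_def bracket_form_split pj \<gamma>A_def \<gamma>B_def ..
    \<comment> \<open>By minimality of \<open>m\<close>, the power \<open>\<phi> ^^ j\<close> does
      not preserve both classes. If it does not exchange them either, one of \<open>A\<close> and
      \<open>B\<close> is disjoint from both target classes, and the determinant factor
      vanishes.\<close>
    have not_fixed: "\<not> (twins c = A \<and> twins d = B)" using minimal[of j] j c(2) d(2) by (auto simp: P_def)
    show ?thesis
    proof (cases "twins c = B \<and> twins d = A")
      case True
      have A: "pairing V \<gamma>A (snd e) = 0" if "e \<in> set (e0 # ga)" for e
        using pairing_disjoint[OF _ suppA[OF that] BA] \<gamma>A True by simp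
      have B: "pairing V \<gamma>B (snd e) = 0" if "e \<in> set (f0 # gb)" for e
        using pairing_disjoint[OF _ suppB[OF that] AB] \<gamma>B True by simp
      have 1: "prod_list (map (\<lambda>e. s * pairing V \<gamma>A (snd e) + pairing V \<gamma>B (snd e)) ga)
          = prod_list (map (\<lambda>e. pairing V \<gamma>B (snd e)) ga)" for s
        by (intro arg_cong[where f = prod_list] map_cong HOL.refl) (simp add: A)
      have 2: "prod_list (map (\<lambda>e. s * pairing V \<gamma>A (snd e) + pairing V \<gamma>B (snd e)) gb)
          = s ^ q * prod_list (map (\<lambda>e. pairing V \<gamma>A (snd e)) gb)" for s
        unfolding q_def by (rule prod_list_scale) (simp add: B)
      show ?thesis unfolding Zs 1 2 using A[of e0] by (simp add: x_def)
    next
      case False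
      then have "twins c \<noteq> A \<and> twins d \<noteq> A \<or> twins c \<noteq> B \<and> twins d \<noteq> B"
        using not_fixed ab(5) by (auto simp: A_def B_def)
      then show ?thesis
      proof
        assume "twins c \<noteq> A \<and> twins d \<noteq> A"
        then have "pairing V \<gamma>A x = 0" "pairing V \<gamma>B x = 0"
          using pairing_disjoint[OF \<gamma>A supp_xy(1)] pairing_disjoint[OF \<gamma>B supp_xy(1)] dis c d by auto
        then show ?thesis unfolding Zs by simp
      next
        assume "twins c \<noteq> B \<and> twins d \<noteq> B"
        then have "pairing V \<gamma>A y = 0" "pairing V \<gamma>B y = 0"
          using pairing_disjoint[OF \<gamma>A supp_xy(2)] pairing_disjoint[OF \<gamma>B supp_xy(2)] disB c d by auto
        then show ?thesis unfolding Zs by simp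
      qed
    qed
  qed
  define r where "r = (\<Sum>j\<in>{..<m} - {0}. Zj j 1)"
  have sum: "(\<Sum>j<m. Zj j s) = s ^ p * Zj 0 1 + s ^ q * r" for s
  proof -
    have "(\<Sum>j<m. Zj j s) = Zj 0 s + (\<Sum>j\<in>{..<m} - {0}. Zj j s)"
      using Pm by (subst sum.remove[of _ 0]) (auto simp: P_def)
    also have "(\<Sum>j\<in>{..<m} - {0}. Zj j s) = s ^ q * r"
      unfolding r_def sum_distrib_left by (intro sum.cong HOL.refl) (rule Zq)
    finally show ?thesis using Z0(1)[of s] by simp
  qed
  have "\<exists>s. (\<Sum>j<m. Zj j s) \<noteq> 0"
  proof (rule ccontr)
    assume "\<not> (\<exists>s. (\<Sum>j<m. Zj j s) \<noteq> 0)"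
    \<comment> \<open>The values at \<open>s = 1\<close> and \<open>s = 2\<close> suffice: together
      they would give \<open>2 ^ p = 2 ^ q\<close>.\<close>
    then have "1 ^ p * Zj 0 1 + 1 ^ q * r = 0" "2 ^ p * Zj 0 1 + 2 ^ q * r = 0"
      unfolding sum by blast+
    then have "r = - Zj 0 1" "2 ^ p * Zj 0 1 + 2 ^ q * r = 0" by (auto simp: eq_neg_iff_add_eq_0 add.commute)
    then have "(2 ^ p - 2 ^ q) * Zj 0 1 = 0" by (simp add: algebra_simps)
    then have "(2::complex) ^ p = 2 ^ q" using Z0(2) by simp
    then have "of_nat (2 ^ p) = (of_nat (2 ^ q) :: complex)" by simp
    then have "(2::nat) ^ p = 2 ^ q" unfolding of_nat_eq_iff .
    then show False using pq by simp
  qed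
  then obtain s where "(\<Sum>j<m. Zj j s) \<noteq> 0" by blast
  then show ?thesis using reidemeister_infinite_if_bracket_form[OF \<phi> perp inv] by (simp add: Zj_def)
qed

theorem R_infinity_if_nonadjacent:
  assumes ab: "a \<in> V" "b \<in> V" "a \<noteq> b" "\<not> adj a b"
  shows "R_infinity_property G"
  unfolding R_infinity_property_def
proof
  fix \<phi> assume "\<phi> \<in> auto G"
  then have hom: "\<phi> \<in> hom G G" and bij: "bij_betw \<phi> (carrier G) (carrier G)"
    by (auto simp: auto_def Bij_def)
  define \<psi> where "\<psi> = inv_into (carrier G) \<phi>"
  have \<psi>: "\<psi> (\<phi> g) = g" "\<phi> (\<psi> g) = g" "\<psi> g \<in> carrier G" if "g \<in> carrier G" for g
    using bij that unfolding \<psi>_def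
    by (auto simp: bij_betw_def inv_into_into f_inv_into_f)
  have "\<psi> (g \<otimes> h) = \<psi> g \<otimes> \<psi> h" if "g \<in> carrier G" "h \<in> carrier G" for g h
  proof -
    have "g \<otimes> h = \<phi> (\<psi> g \<otimes> \<psi> h)" using that \<psi> hom_mult[OF hom] by simp
    then show ?thesis using that \<psi> by simp
  qed
  then have "aut \<phi> \<psi>" using hom \<psi> by (auto simp: aut_def hom_def)
  then show "reidemeister_number G \<phi> = \<infinity>"
    using reidemeister_infinite_same_class[OF _ ab] reidemeister_infinite_distinct_classes[OF _ ab]
    by blast
qed

end

section \<open>Regular graphs\<close>

theorem RAAG_R_infinity_if_regular:
  fixes \<Gamma> :: "('a, 'b) pre_digraph"
  assumes "graph \<Gamma>" and regular: "regular_graph k \<Gamma>"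
    and ab: "a \<in> verts \<Gamma>" "b \<in> verts \<Gamma>" "a \<noteq> b" "(a, b) \<notin> arcs_ends \<Gamma>"
  shows "R_infinity_property (RAAG \<Gamma>)"
proof -
  interpret graph \<Gamma> by fact
  define adj where "adj v w \<longleftrightarrow> (v, w) \<in> arcs_ends \<Gamma>" for v w
  have adjV: "v \<in> verts \<Gamma>" "w \<in> verts \<Gamma>" if "adj v w" for v w
    using that by (auto simp: adj_def arcs_ends_conv)
  define R where "R = {commutator_word v w |v w. v \<in> verts \<Gamma> \<and> w \<in> verts \<Gamma> \<and> adj v w}"
  have RAAG: "RAAG \<Gamma> = presented_group (verts \<Gamma>) R"
  proof -
    have "{commutator_word v w |v w. (v, w) \<in> arcs_ends \<Gamma>} = R"
      unfolding R_def adj_def[symmetric] using adjV by blast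
    then show ?thesis by (simp add: RAAG_def)
  qed
  have sym: "adj w v" if "adj v w" for v w
    using that sym_arcs by (auto simp: adj_def symmetric_def sym_def)
  have irr: "\<not> adj v v" for v using adj_not_same by (auto simp: adj_def)
  obtain gen ex where raag: "raag_group (presented_group (verts \<Gamma>) R) (verts \<Gamma>) adj gen ex"
    using raag_group_presented[OF R_def finite_verts sym irr] by blast
  interpret raag_group "presented_group (verts \<Gamma>) R" "verts \<Gamma>" adj gen ex by (rule raag)
  have "card (nbhd v) = k" if v: "v \<in> verts \<Gamma>" for v
  proof -
    \<comment> \<open>Without parallel arcs, the arcs leaving \<open>v\<close> correspond to its
      neighbours, so the out-degree is the size of \<open>nbhd v\<close>.\<close>
    have "bij_betw (head \<Gamma>) (out_arcs \<Gamma> v) (nbhd v)"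
      unfolding bij_betw_def
    proof
      show "inj_on (head \<Gamma>) (out_arcs \<Gamma> v)"
        using no_multi_arcs by (auto intro!: inj_onI simp: arc_to_ends_def)
      show "head \<Gamma> ` out_arcs \<Gamma> v = nbhd v"
        using adjV by (auto simp: nbhd_def adj_def arcs_ends_conv)
    qed
    then show ?thesis
      using regular v bij_betw_same_card by (fastforce simp: regular_graph_def out_degree_def)
  qed
  then interpret regular_raag_group "presented_group (verts \<Gamma>) R" "verts \<Gamma>" adj gen ex k
    by unfold_locales
  show ?thesis
    unfolding RAAG using ab by (intro R_infinity_if_nonadjacent[of a b]) (auto simp: adj_def)
qed

theorem corollary5p2p9:
  fixes \<Gamma> :: "('a, 'b) pre_digraph" and n :: nat
  assumes "graph \<Gamma>" and "verts \<Gamma> \<noteq> {}"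
    and "card (verts \<Gamma>) = n"
    and "\<not> complete_digraph n \<Gamma>"
    and "regular_graph 2 \<Gamma> \<or> (n \<ge> 3 \<and> regular_graph (n - 3) \<Gamma>)"
  shows "R_infinity_property (RAAG \<Gamma>)"
proof -
  interpret graph \<Gamma> by fact
  have "arcs_ends \<Gamma> \<subseteq> {(u, v). (u, v) \<in> verts \<Gamma> \<times> verts \<Gamma> \<and> u \<noteq> v}"
    using adj_not_same by (auto simp: arcs_ends_conv no_loops)
  \<comment> \<open>Completeness means that every pair of distinct vertices is an arc; its failure
    yields the non-adjacent pair.\<close>
  moreover have "arcs_ends \<Gamma> \<noteq> {(u, v). (u, v) \<in> verts \<Gamma> \<times> verts \<Gamma> \<and> u \<noteq> v}"
    using assms(1,3,4) by (simp add: complete_digraph_def)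
  ultimately obtain a b where "a \<in> verts \<Gamma>" "b \<in> verts \<Gamma>" "a \<noteq> b" "(a, b) \<notin> arcs_ends \<Gamma>"
    by blast
  then show ?thesis using RAAG_R_infinity_if_regular[OF assms(1)] assms(5) by blast
qed

end
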